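(* Let $\theta>0$ and $n\in\mathbb{N}$. Let $\mathbf{W}=(W_{n,k})_{n\in\mathbb{N},k\in[n]}$ be an array of non-negative real random variables (not necessarily ordered), and suppose that, conditionally given $\mathbf{W}$, $(X_k)_{k\in\mathbb{N}}$ are mutually independent non-negative integer-valued random variables with $\lambda_k(\mathbf{W}):=\mathbb{E}[X_k\mid\mathbf{W}]\in[0,\infty)$. Let $S_n=\sum_{k=1}^nW_{n,k}X_k$. Let $0=t_0\le t_1\le\dots\le t_n$ be any non-decreasing grid, possibly dependent on $\mathbf{W}$ but deterministic conditionally given $\mathbf{W}$ (i.e. $\mathbf{W}$-measurable). Define $$\varepsilon_n^{1,1}(\mathbf{W}):=\frac{\theta t_n}{4}\delta_n^{(t)}+\Big(1+\frac{t_n}{2}\Big)D_n^{(t)*}+\theta|t_n-1|+\frac12\sum_{k=1}^n\lambda_k(\mathbf{W})W_{n,k}\Big(|W_{n,k}-t_k|+W_{n,k}\,d_1(X_k^*,X_k+1\mid\mathbf{W})\Big).$$ Then $$d_{1,1}(S_n,D_\theta)\le\mathbb{E}[\varepsilon_n^{1,1}(\mathbf{W})].$$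
   Context: $[n]=\{1,\dots,n\}$. $D_\theta$ has the generalized Dickman distribution with mean $\theta$: the unique non-negative solution (in law) of $D\stackrel{d}{=}U^{1/\theta}(D+1)$ with $U$ uniform on $[0,1]$ independent of $D$. $d_{1,1}(X,Y):=\sup_{h\in\mathcal{H}_{1,1}}|\mathbb{E}h(X)-\mathbb{E}h(Y)|$, where $\mathcal{H}_{1,1}$ is the set of differentiable $h:\mathbb{R}\to\mathbb{R}$ such that $h$ and $h'$ are both Lipschitz with constant at most $1$. $\Delta t_k:=t_k-t_{k-1}$, $D_{n,k}^{(t)}:=\sum_{j=1}^k(\lambda_j(\mathbf{W})W_{n,j}-\theta\Delta t_j)$, $\delta_n^{(t)}:=\max_{k\in[n]}\Delta t_k$, $D_n^{(t)*}:=\max_{k\in[n]}|D_{n,k}^{(t)}|$. Conditionally given $\mathbf{W}$, $X_k^*$ has the size-biased law of $X_k$: $\mathbb{E}[X_kf(X_k)\mid\mathbf{W}]=\lambda_k(\mathbf{W})\mathbb{E}[f(X_k^* )\mid\mathbf{W}]$ for all $f$ for which the expectations exist. $d_1(X,Y):=\inf\mathbb{E}|X-Y|$ over all couplings is the Wasserstein distance, and $d_1(\cdot,\cdot\mid\mathbf{W})$ is this distance between conditional laws given $\mathbf{W}$. A summand with $\lambda_k(\mathbf{W})=0$ is read as $0$. The bound is regarded as trivial if its right-hand side is infinite. *)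

theory Defs
  imports "HOL-Probability.Probability"
begin

text \<open>Laws on the real line are Borel measures of type \<^typ>\<open>real measure\<close>.\<close>

definition is_dickman :: "real \<Rightarrow> real measure \<Rightarrow> bool" where
  "is_dickman \<theta> \<mu> \<longleftrightarrow>
     prob_space \<mu> \<and> sets \<mu> = sets borel \<and> (AE x in \<mu>. 0 \<le> x) \<and>
     distr (uniform_measure lborel {0..1::real} \<Otimes>\<^sub>M \<mu>) borel
       (\<lambda>(u, x). u powr (1 / \<theta>) * (x + 1)) = \<mu>"

definition H11 :: "(real \<Rightarrow> real) set" where
  "H11 = {h. (\<forall>x. h differentiable (at x)) \<and> 1-lipschitz_on UNIV h \<and> 1-lipschitz_on UNIV (deriv h)}"

text \<open>Functions in \<^const>\<open>H11\<close> have at most linear growth, so all integrals below exist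
  if both laws have a finite first moment.\<close>

definition d11 :: "real measure \<Rightarrow> real measure \<Rightarrow> ennreal" where
  "d11 \<mu> \<nu> = (SUP h\<in>H11. ennreal \<bar>(\<integral>x. h x \<partial>\<mu>) - (\<integral>x. h x \<partial>\<nu>)\<bar>)"

definition couplings :: "real measure \<Rightarrow> real measure \<Rightarrow> (real \<times> real) measure set" where
  "couplings \<mu> \<nu> = {\<gamma>. prob_space \<gamma> \<and> sets \<gamma> = sets (borel \<Otimes>\<^sub>M borel) \<and>
     distr \<gamma> borel fst = \<mu> \<and> distr \<gamma> borel snd = \<nu>}"

definition wasserstein1 :: "real measure \<Rightarrow> real measure \<Rightarrow> ennreal" where
  "wasserstein1 \<mu> \<nu> = (INF \<gamma>\<in>couplings \<mu> \<nu>. \<integral>\<^sup>+ z. ennreal \<bar>fst z - snd z\<bar> \<partial>\<gamma>)"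

definition real_law :: "nat pmf \<Rightarrow> real measure" where
  "real_law p = distr (measure_pmf p) borel real"

text \<open>\<open>is_size_biased p q\<close>: the law \<open>q\<close> of \<open>X\<^sup>*\<close> is size-biased for the law \<open>p\<close> of \<open>X\<close>.
  If \<open>p\<close> has mean 0, any \<open>q\<close> qualifies.\<close>

definition is_size_biased :: "nat pmf \<Rightarrow> nat pmf \<Rightarrow> bool" where
  "is_size_biased p q \<longleftrightarrow>
     (\<forall>f :: nat \<Rightarrow> real.
        integrable (measure_pmf p) (\<lambda>x. real x * f x) \<longrightarrow> integrable (measure_pmf q) f \<longrightarrow>
        measure_pmf.expectation p (\<lambda>x. real x * f x) =
          measure_pmf.expectation p real * measure_pmf.expectation q f)"

text \<open>The \<open>\<sigma>\<close>-algebra generated by the triangular array \<open>W m k\<close>, \<open>1 \<le> k \<le> m\<close>.\<close>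

definition array_sigma :: "'a measure \<Rightarrow> (nat \<Rightarrow> nat \<Rightarrow> 'a \<Rightarrow> real) \<Rightarrow> 'a measure" where
  "array_sigma M W = sigma (space M)
     {W m k -` B \<inter> space M | m k B. 1 \<le> k \<and> k \<le> m \<and> B \<in> sets borel}"

definition cond_prob_sub :: "'a measure \<Rightarrow> 'a measure \<Rightarrow> ('a \<Rightarrow> bool) \<Rightarrow> 'a \<Rightarrow> real" where
  "cond_prob_sub M F P = real_cond_exp M F (indicator {\<omega> \<in> space M. P \<omega>})"

definition cond_indep_nat_vars ::
  "'a measure \<Rightarrow> 'a measure \<Rightarrow> (nat \<Rightarrow> 'a \<Rightarrow> nat) \<Rightarrow> nat set \<Rightarrow> bool" where
  "cond_indep_nat_vars M F X I \<longleftrightarrow>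
     (\<forall>J A. finite J \<longrightarrow> J \<subseteq> I \<longrightarrow>
        (AE \<omega> in M. cond_prob_sub M F (\<lambda>\<omega>'. \<forall>j\<in>J. X j \<omega>' \<in> A j) \<omega> =
           (\<Prod>j\<in>J. cond_prob_sub M F (\<lambda>\<omega>'. X j \<omega>' \<in> A j) \<omega>)))"

text \<open>\<open>\<kappa>\<close> is a regular conditional distribution of \<open>Y\<close> given \<open>F\<close>.\<close>

definition is_cond_law ::
  "'a measure \<Rightarrow> 'a measure \<Rightarrow> ('a \<Rightarrow> nat) \<Rightarrow> ('a \<Rightarrow> nat pmf) \<Rightarrow> bool" where
  "is_cond_law M F Y \<kappa> \<longleftrightarrow>
     (\<forall>A. (\<lambda>\<omega>. measure_pmf.prob (\<kappa> \<omega>) A) \<in> borel_measurable F \<and>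
          (AE \<omega> in M. measure_pmf.prob (\<kappa> \<omega>) A = cond_prob_sub M F (\<lambda>\<omega>'. Y \<omega>' \<in> A) \<omega>))"

definition grid_mesh :: "nat \<Rightarrow> (nat \<Rightarrow> real) \<Rightarrow> real" where
  "grid_mesh n t = Max ((\<lambda>k. t k - t (k - 1)) ` {1..n})"

definition grid_dev :: "real \<Rightarrow> (nat \<Rightarrow> real) \<Rightarrow> (nat \<Rightarrow> real) \<Rightarrow> (nat \<Rightarrow> real) \<Rightarrow> nat \<Rightarrow> real" where
  "grid_dev \<theta> w lam t k = (\<Sum>j=1..k. lam j * w j - \<theta> * (t j - t (j - 1)))"

definition grid_dev_max ::
  "real \<Rightarrow> nat \<Rightarrow> (nat \<Rightarrow> real) \<Rightarrow> (nat \<Rightarrow> real) \<Rightarrow> (nat \<Rightarrow> real) \<Rightarrow> real" where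
  "grid_dev_max \<theta> n w lam t = Max ((\<lambda>k. \<bar>grid_dev \<theta> w lam t k\<bar>) ` {1..n})"

text \<open>The error term as a function of the realised weights \<open>w\<close>, conditional means \<open>lam\<close>, grid \<open>t\<close>
  and conditional distances \<open>d k = d\<^sub>1(X\<^sub>k\<^sup>*, X\<^sub>k + 1 | W)\<close>.  It is extended-valued since \<open>d k\<close> may be
  infinite; by the convention \<open>0 * \<infinity> = 0\<close> a summand with \<open>lam k = 0\<close> vanishes, whatever \<open>d k\<close> is.\<close>

definition eps11 ::
  "real \<Rightarrow> nat \<Rightarrow> (nat \<Rightarrow> real) \<Rightarrow> (nat \<Rightarrow> real) \<Rightarrow> (nat \<Rightarrow> real) \<Rightarrow> (nat \<Rightarrow> ennreal) \<Rightarrow> ennreal" where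
  "eps11 \<theta> n w lam t d =
     ennreal (\<theta> * t n / 4 * grid_mesh n t + (1 + t n / 2) * grid_dev_max \<theta> n w lam t
              + \<theta> * \<bar>t n - 1\<bar>)
     + ennreal (1 / 2) *
         (\<Sum>k=1..n. ennreal (lam k * w k) * (ennreal \<bar>w k - t k\<bar> + ennreal (w k) * d k))"

end

(* Stein's method. For h in H11 there is f with |f| <= 1, Lipschitz with constant 1/2, such that
     x f(x) - theta * (integral of f over [x, x + 1]) = h(x) - E h(D)   for x >= 0,
   so E h(S) - E h(D) is the expectation of the left-hand side at S. Differentiating the equation
   shows that f solves the fixed-point equation
     f(x) = integral over [0, 1] of v^theta (h'(v x) + theta f(v x + 1)) dv,
   whose right-hand side is a contraction preserving exactly these two bounds; the constant is
   identified by applying the distributional fixed-point equation of D to an antiderivative of f.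
   Conditionally on W, size biasing turns E[X_k f(S)] into lambda_k E[f(S + W_k)] up to the
   Wasserstein term, f(S + W_k) is replaced by f(S + t_k), summation by parts exchanges the weights
   lambda_k W_k for theta (t_k - t_(k-1)), and the resulting Riemann sum is compared with the
   integral of f over [S, S + t_n] and then over [S, S + 1]. *)
theory Submission
  imports Defs
begin

section \<open>The Stein equation\<close>

text \<open>Three obstacles shape the proof. The Stein equation looks forward: f at x depends on f
  near x + 1, so it cannot be integrated outward from 0. As a fixed-point problem the shift is
  harmless, because f enters with total weight \<theta> / (\<theta> + 1) < 1. Next, no moments are
  given: \<open>is_dickman\<close> mentions none and S is not assumed integrable, while h grows
  linearly. For D, bounded test functions in the Stein identity yield the mean; for S the bound
  itself does, because the conditional mean of S is at most \<theta> plus the error term, so a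
  finite right-hand side forces integrability. Finally, the error term contains an infimum over
  couplings and has no evident measurability. It is therefore never split under the outer integral
  and serves only as an upper bound, for which monotonicity of the nonnegative integral is
  enough.\<close>

lemma integral_powr_01:
  fixes a :: real
  assumes "a > -1"
  shows "integral {0..1} (\<lambda>v. v powr a) = 1 / (a + 1)"
  using has_integral_powr_from_0[OF assms, of 1] by (simp add: integral_unique)

lemma continuous_on_powr_Icc:
  fixes a :: real
  assumes "a > 0"
  shows "continuous_on {0..b} (\<lambda>v. v powr a)"
  using assms by (intro continuous_on_powr' continuous_intros) auto

lemma abs_integral_powr_le:
  fixes \<phi> :: "real \<Rightarrow> real"
  assumes "\<theta> > 0" "continuous_on {0..1} \<phi>" "\<And>v. v \<in> {0..1} \<Longrightarrow> \<bar>\<phi> v\<bar> \<le> c"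
  shows "\<bar>integral {0..1} (\<lambda>v. v powr \<theta> * \<phi> v)\<bar> \<le> c / (\<theta> + 1)"
proof -
  have "norm (integral {0..1} (\<lambda>v. v powr \<theta> * \<phi> v)) \<le> integral {0..1} (\<lambda>v. v powr \<theta> * c)"
    using assms
    by (intro integral_norm_bound_integral integrable_continuous_interval continuous_on_mult
          continuous_on_powr_Icc continuous_on_const)
       (auto simp: abs_mult intro!: mult_left_mono)
  also have "\<dots> = c / (\<theta> + 1)"
    using assms by (simp add: integral_powr_01)
  finally show ?thesis by simp
qed

text \<open>Differences between values at \<open>v * x\<close> and \<open>v * y\<close> carry a
  factor v, which raises the exponent by one. The gain from \<theta> + 1 to \<theta> + 2 is what
  keeps the Lipschitz constant of f at 1/2.\<close>

lemma abs_integral_powr_le':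
  fixes \<phi> :: "real \<Rightarrow> real"
  assumes "\<theta> > 0" "continuous_on {0..1} \<phi>" "\<And>v. v \<in> {0..1} \<Longrightarrow> \<bar>\<phi> v\<bar> \<le> c * v"
  shows "\<bar>integral {0..1} (\<lambda>v. v powr \<theta> * \<phi> v)\<bar> \<le> c / (\<theta> + 2)"
proof -
  have "norm (integral {0..1} (\<lambda>v. v powr \<theta> * \<phi> v)) \<le> integral {0..1} (\<lambda>v. v powr (\<theta> + 1) * c)"
  proof (intro integral_norm_bound_integral integrable_continuous_interval)
    fix v :: real assume v: "v \<in> {0..1}"
    have "v powr \<theta> * \<bar>\<phi> v\<bar> \<le> v powr \<theta> * (c * v)"
      using assms(3)[OF v] by (intro mult_left_mono) auto
    also have "\<dots> = v powr (\<theta> + 1) * c"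
      using v by (cases "v = 0") (auto simp: powr_add)
    finally show "norm (v powr \<theta> * \<phi> v) \<le> v powr (\<theta> + 1) * c"
      by (simp add: abs_mult)
  next
    show "continuous_on {0..1} (\<lambda>v. v powr \<theta> * \<phi> v)"
      using assms by (intro continuous_on_mult continuous_on_powr_Icc)
    show "continuous_on {0..1} (\<lambda>v. v powr (\<theta> + 1) * c)"
      using assms(1) by (intro continuous_on_mult continuous_on_powr_Icc continuous_on_const) simp
  qed
  also have "\<dots> = c / (\<theta> + 2)"
    using assms integral_powr_01[of "\<theta> + 1"] by (simp add: add_ac)
  finally show ?thesis by simp
qed

text \<open>With \<open>V = U\<^sup>1\<^sup>/\<^sup>\<theta>\<close>, whose density is \<open>\<theta> v powr (\<theta> - 1)\<close>, this is
  \<open>E[V * (k (V * x) + \<theta> * f (V * x + 1))] / \<theta>\<close>.\<close>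

definition stein_op :: "real \<Rightarrow> (real \<Rightarrow> real) \<Rightarrow> (real \<Rightarrow> real) \<Rightarrow> real \<Rightarrow> real" where
  "stein_op \<theta> k f x = integral {0..1} (\<lambda>v. v powr \<theta> * (k (v * x) + \<theta> * f (v * x + 1)))"

context
  fixes \<theta> :: real and k :: "real \<Rightarrow> real"
  assumes \<theta>: "\<theta> > 0" and k_lip: "1-lipschitz_on UNIV k" and k_bd: "\<And>x. \<bar>k x\<bar> \<le> 1"
begin

lemma stein_kernel_continuous: "continuous_on UNIV k"
  by (rule lipschitz_on_continuous_on[OF k_lip])

lemma stein_integrand_continuous:
  assumes "continuous_on UNIV f"
  shows "continuous_on S (\<lambda>v::real. k (v * x) + \<theta> * f (v * x + 1))"
  by (intro continuous_on_add continuous_on_mult continuous_on_const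
        continuous_on_compose2[OF stein_kernel_continuous] continuous_on_compose2[OF assms] continuous_on_id) auto

text \<open>The bound 1 is forced: a bound c on f is returned as (1 + \<theta> c) / (\<theta> + 1),
  and this equals c only for c = 1.\<close>

lemma stein_op_bound:
  assumes "continuous_on UNIV f" "\<And>x. \<bar>f x\<bar> \<le> 1"
  shows "\<bar>stein_op \<theta> k f x\<bar> \<le> 1"
proof -
  have "\<bar>k y + \<theta> * f z\<bar> \<le> 1 + \<theta>" for y z
  proof -
    have "\<bar>k y + \<theta> * f z\<bar> \<le> \<bar>k y\<bar> + \<theta> * \<bar>f z\<bar>"
      using \<theta> abs_triangle_ineq[of "k y" "\<theta> * f z"] by (simp add: abs_mult)
    also have "\<dots> \<le> 1 + \<theta> * 1" using \<theta> assms k_bd by (intro add_mono mult_left_mono) auto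
    finally show ?thesis by simp
  qed
  from abs_integral_powr_le[OF \<theta> stein_integrand_continuous[OF assms(1)] this]
  have "\<bar>stein_op \<theta> k f x\<bar> \<le> (1 + \<theta>) / (\<theta> + 1)" unfolding stein_op_def .
  with \<theta> show ?thesis by (simp add: add.commute)
qed

lemma stein_integrand_integrable:
  assumes "continuous_on UNIV f"
  shows "(\<lambda>v. v powr \<theta> * (k (v * x) + \<theta> * f (v * x + 1))) integrable_on {0..1}"
  by (intro integrable_continuous_interval continuous_on_mult continuous_on_powr_Icc stein_integrand_continuous assms \<theta>)

text \<open>A Lipschitz constant L of f is returned as (1 + \<theta> L) / (\<theta> + 2), whose
  fixed point is L = 1/2 for every \<theta>.\<close>

lemma stein_op_lipschitz:
  assumes "(1/2)-lipschitz_on UNIV f"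
  shows "(1/2)-lipschitz_on UNIV (stein_op \<theta> k f)"
proof (rule lipschitz_onI)
  fix x y :: real
  have fc: "continuous_on UNIV f" by (rule lipschitz_on_continuous_on[OF assms])
  have "stein_op \<theta> k f x - stein_op \<theta> k f y =
    integral {0..1} (\<lambda>v. v powr \<theta> * ((k (v * x) + \<theta> * f (v * x + 1)) - (k (v * y) + \<theta> * f (v * y + 1))))"
    unfolding stein_op_def right_diff_distrib[of "_ powr _"]
    by (intro Henstock_Kurzweil_Integration.integral_diff[symmetric] stein_integrand_integrable fc)
  also have "\<bar>\<dots>\<bar> \<le> (\<bar>x - y\<bar> * (1 + \<theta> / 2)) / (\<theta> + 2)"
  proof (rule abs_integral_powr_le'[OF \<theta>])
    show "continuous_on {0..1} (\<lambda>v. k (v * x) + \<theta> * f (v * x + 1) - (k (v * y) + \<theta> * f (v * y + 1)))"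
      by (intro continuous_on_diff stein_integrand_continuous fc)
    fix v :: real assume v: "v \<in> {0..1}"
    have 1: "\<bar>k (v * x) - k (v * y)\<bar> \<le> v * \<bar>x - y\<bar>"
      using lipschitz_onD[OF k_lip, of "v * x" "v * y"] v
      by (simp add: dist_real_def abs_mult flip: right_diff_distrib)
    have "\<bar>f (v * x + 1) - f (v * y + 1)\<bar> \<le> 1/2 * (v * \<bar>x - y\<bar>)"
      using lipschitz_onD[OF assms, of "v * x + 1" "v * y + 1"] v
      by (simp add: dist_real_def abs_mult flip: right_diff_distrib)
    hence 2: "\<bar>\<theta> * (f (v * x + 1) - f (v * y + 1))\<bar> \<le> \<theta> * (1/2 * (v * \<bar>x - y\<bar>))"
      using \<theta> by (simp add: abs_mult)
    have "k (v * x) + \<theta> * f (v * x + 1) - (k (v * y) + \<theta> * f (v * y + 1)) =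
      (k (v * x) - k (v * y)) + \<theta> * (f (v * x + 1) - f (v * y + 1))"
      by (simp add: algebra_simps)
    also have "\<bar>\<dots>\<bar> \<le> v * \<bar>x - y\<bar> + \<theta> * (1/2 * (v * \<bar>x - y\<bar>))"
      using 1 2 by (rule order_trans[OF abs_triangle_ineq add_mono])
    also have "\<dots> = \<bar>x - y\<bar> * (1 + \<theta> / 2) * v" by (simp add: algebra_simps)
    finally show "\<bar>k (v * x) + \<theta> * f (v * x + 1) - (k (v * y) + \<theta> * f (v * y + 1))\<bar> \<le> \<bar>x - y\<bar> * (1 + \<theta> / 2) * v" .
  qed
  also have "\<dots> = 1/2 * \<bar>x - y\<bar>" using \<theta> by (simp add: field_simps)
  finally show "dist (stein_op \<theta> k f x) (stein_op \<theta> k f y) \<le> 1/2 * dist x y"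
    by (simp add: dist_real_def)
qed simp

text \<open>The kernel \<open>k\<close> cancels, and the mass 1 / (\<theta> + 1) of
  \<open>v powr \<theta>\<close> outweighs the factor \<theta> in front of f.\<close>

lemma stein_op_contraction:
  assumes "continuous_on UNIV f" "continuous_on UNIV g" "\<And>x. \<bar>f x - g x\<bar> \<le> d"
  shows "\<bar>stein_op \<theta> k f x - stein_op \<theta> k g x\<bar> \<le> \<theta> / (\<theta> + 1) * d"
proof -
  have "stein_op \<theta> k f x - stein_op \<theta> k g x =
    integral {0..1} (\<lambda>v. v powr \<theta> * ((k (v * x) + \<theta> * f (v * x + 1)) - (k (v * x) + \<theta> * g (v * x + 1))))"
    unfolding stein_op_def right_diff_distrib[of "_ powr _"]
    by (intro Henstock_Kurzweil_Integration.integral_diff[symmetric] stein_integrand_integrable assms)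
  also have "\<bar>\<dots>\<bar> \<le> (\<theta> * d) / (\<theta> + 1)"
  proof (rule abs_integral_powr_le[OF \<theta>])
    show "continuous_on {0..1} (\<lambda>v. k (v * x) + \<theta> * f (v * x + 1) - (k (v * x) + \<theta> * g (v * x + 1)))"
      by (intro continuous_on_diff stein_integrand_continuous assms)
    fix v :: real
    have "\<bar>\<theta> * (f (v * x + 1) - g (v * x + 1))\<bar> \<le> \<theta> * d"
      using \<theta> assms(3) by (simp add: abs_mult)
    thus "\<bar>k (v * x) + \<theta> * f (v * x + 1) - (k (v * x) + \<theta> * g (v * x + 1))\<bar> \<le> \<theta> * d"
      by (simp add: algebra_simps)
  qed
  finally show ?thesis by simp
qed

lemma stein_fixed_point:
  "\<exists>f. (\<forall>x. \<bar>f x\<bar> \<le> 1) \<and> (1/2)-lipschitz_on UNIV f \<and> stein_op \<theta> k f = f"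
proof -
  \<comment> \<open>Both bounds are built into the set on which Banach's theorem is applied, so the
    fixed point inherits them; being pointwise inequalities, they survive uniform limits and the set
    is complete.\<close>
  define S where "S = {f :: real \<Rightarrow>\<^sub>C real. \<forall>x y. \<bar>f x\<bar> \<le> 1 \<and> \<bar>f x - f y\<bar> \<le> 1/2 * \<bar>x - y\<bar>}"
  define T where "T = (\<lambda>f :: real \<Rightarrow>\<^sub>C real. Bcontfun (stein_op \<theta> k f))"
  have ev: "continuous_on UNIV (\<lambda>f :: real \<Rightarrow>\<^sub>C real. f x)" for x
    by (rule lipschitz_on_continuous_on[of 1]) (auto intro!: lipschitz_onI dist_bounded)
  have lip: "(1/2)-lipschitz_on UNIV (apply_bcontfun f)" if "f \<in> S" for f
    using that by (auto simp: S_def dist_real_def intro!: lipschitz_onI)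
  have T: "apply_bcontfun (T f) = stein_op \<theta> k f" if "f \<in> S" for f
    unfolding T_def using that
    by (intro Bcontfun_inverse bcontfun_normI[where b=1]
          lipschitz_on_continuous_on[OF stein_op_lipschitz[OF lip]])
       (auto intro!: stein_op_bound simp: S_def)
  have "\<exists>!f\<in>S. T f = f"
  proof (rule Banach_fix)
    have "closed S" unfolding S_def
      by (intro closed_Collect_all closed_Collect_conj closed_Collect_le ev continuous_intros)
    thus "uniform_space_class.complete S" by (simp add: complete_eq_closed)
    have "0 \<in> S" by (auto simp: S_def)
    thus "S \<noteq> {}" by auto
    show "0 \<le> \<theta> / (\<theta> + 1)" "\<theta> / (\<theta> + 1) < 1" using \<theta> by auto
    show "T ` S \<subseteq> S"
    proof (rule image_subsetI)
      fix f assume f: "f \<in> S"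
      from lipschitz_onD[OF stein_op_lipschitz[OF lip[OF f]]]
      show "T f \<in> S" using f stein_op_bound[of f]
        by (auto simp: S_def T[OF f] dist_real_def)
    qed
    fix f g assume fg: "f \<in> S" "g \<in> S"
    show "dist (T f) (T g) \<le> \<theta> / (\<theta> + 1) * dist f g"
    proof (rule dist_bound)
      fix x
      show "dist (T f x) (T g x) \<le> \<theta> / (\<theta> + 1) * dist f g"
        unfolding T[OF fg(1)] T[OF fg(2)] dist_real_def
        by (rule stein_op_contraction) (use dist_bounded[of f _ g] in \<open>auto simp: dist_real_def\<close>)
    qed
  qed
  then obtain f where f: "f \<in> S" "T f = f" by auto
  from T[OF f(1)] f(2) have "stein_op \<theta> k f = f" by simp
  thus ?thesis using f(1) lip[OF f(1)] by (intro exI[of _ "apply_bcontfun f"]) (auto simp: S_def)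
qed

text \<open>Substituting y = v x turns the fixed-point equation into
  \<open>x powr (\<theta> + 1) * f x\<close> = integral over [0, x] of
  \<open>y powr \<theta> * (k y + \<theta> * f (y + 1))\<close>. The right-hand side is
  differentiable although f is merely continuous. Isolating x f x means dividing by
  \<open>x powr \<theta>\<close>, hence x > 0.\<close>

lemma stein_op_deriv:
  assumes fc: "continuous_on UNIV f" and eq: "stein_op \<theta> k f = f" and x: "x > 0"
  shows "((\<lambda>x. x * f x) has_real_derivative (k x + \<theta> * f (x + 1) - \<theta> * f x)) (at x)"
proof -
  define \<phi> where "\<phi> = (\<lambda>y. k y + \<theta> * f (y + 1))"
  define I where "I = (\<lambda>x. integral {0..x} (\<lambda>y. y powr \<theta> * \<phi> y))"
  have \<phi>: "continuous_on S \<phi>" for S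
    using stein_integrand_continuous[OF fc, of _ 1] by (simp add: \<phi>_def)
  have cont: "continuous_on {0..b} (\<lambda>y. y powr \<theta> * \<phi> y)" for b
    by (intro continuous_on_mult continuous_on_powr_Icc \<phi> \<theta>)
  have I: "I z = z powr (\<theta> + 1) * f z" if z: "z > 0" for z
  proof -
    have "((\<lambda>y. y powr \<theta> * \<phi> y) has_integral I z) {0..z}"
      unfolding I_def by (intro integrable_integral integrable_continuous_interval cont)
    from has_integral_stretch_real[OF this, of z] z
    have "((\<lambda>v. (z * v) powr \<theta> * \<phi> (z * v)) has_integral (1 / z) * I z) ((\<lambda>x. x / z) ` {0..z})"
      by simp
    moreover have "(\<lambda>x. x / z) ` {0..z} = {0..1}"
      using z by (simp add: image_divide_atLeastAtMost)
    ultimately have "((\<lambda>v. (z * v) powr \<theta> * \<phi> (z * v)) has_integral (1 / z) * I z) {0..1}" by simp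
    from has_integral_mult_right[OF this, of "z powr (-\<theta>)"]
    have "((\<lambda>v. z powr (-\<theta>) * ((z * v) powr \<theta> * \<phi> (z * v))) has_integral z powr (-\<theta>) * ((1 / z) * I z)) {0..1}" .
    also have "?this \<longleftrightarrow> ((\<lambda>v. v powr \<theta> * (k (v * z) + \<theta> * f (v * z + 1))) has_integral z powr (-\<theta>) * ((1 / z) * I z)) {0..1}"
      by (intro has_integral_cong) (use z in \<open>auto simp: powr_mult \<phi>_def mult_ac powr_minus\<close>)
    finally have "stein_op \<theta> k f z = z powr (-\<theta>) * ((1 / z) * I z)"
      unfolding stein_op_def by (rule integral_unique)
    hence "f z = z powr (-\<theta>) * ((1 / z) * I z)" unfolding eq .
    thus ?thesis using z by (simp add: powr_add powr_minus field_simps)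
  qed
  have "(I has_real_derivative x powr \<theta> * \<phi> x) (at x within {0..x+1})"
    unfolding I_def by (rule integral_has_real_derivative[OF cont]) (use x in auto)
  moreover have "at x within {0..x+1} = at x" by (rule at_within_Icc_at) (use x in auto)
  ultimately have dI: "(I has_real_derivative x powr \<theta> * \<phi> x) (at x)" by simp
  have "((\<lambda>z. z powr (-\<theta>) * I z) has_real_derivative
           (-\<theta> * x powr (-\<theta> - 1)) * I x + (x powr \<theta> * \<phi> x) * x powr (-\<theta>)) (at x)"
    by (rule DERIV_mult[OF has_real_derivative_powr dI]) (use x in auto)
  also have "(-\<theta> * x powr (-\<theta> - 1)) * I x + (x powr \<theta> * \<phi> x) * x powr (-\<theta>) = k x + \<theta> * f (x + 1) - \<theta> * f x"
    using x by (simp add: I \<phi>_def powr_diff powr_add powr_minus field_simps)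
  finally show ?thesis
  proof (rule has_field_derivative_transform_within_open)
    show "open {0::real<..}" "x \<in> {0<..}" using x by (auto simp: open_greaterThan)
    show "z powr (-\<theta>) * I z = z * f z" if "z \<in> {0<..}" for z
      using that by (simp add: I powr_add powr_minus field_simps)
  qed
qed

end

lemma lipschitz_on_UNIV_abs_deriv_le:
  fixes h :: "real \<Rightarrow> real"
  assumes "C-lipschitz_on UNIV h" "(h has_real_derivative d) (at x)"
  shows "\<bar>d\<bar> \<le> C"
proof -
  have "((\<lambda>e. \<bar>(h (x + e) - h x) / e\<bar>) \<longlongrightarrow> \<bar>d\<bar>) (at 0)"
    using assms(2) by (intro tendsto_rabs) (simp add: DERIV_def)
  moreover have "\<bar>(h (x + e) - h x) / e\<bar> \<le> C" if "e \<noteq> 0" for e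
    using lipschitz_onD[OF assms(1), of "x + e" x] that by (simp add: dist_real_def field_simps)
  hence "\<forall>\<^sub>F e in at 0. \<bar>(h (x + e) - h x) / e\<bar> \<le> C"
    by (auto simp: eventually_at_filter)
  ultimately show ?thesis by (rule tendsto_upperbound) simp
qed

text \<open>The fixed point solves only the derivative of the Stein equation, and only for x > 0.
  The residual \<open>K\<close> is therefore constant there, and continuity carries the constant to
  x = 0, a value that S takes when all X_k vanish. What the constant is remains open here.\<close>

lemma stein_solution_const:
  assumes \<theta>: "\<theta> > 0" and h: "h \<in> H11"
  obtains f F c where "\<And>x. \<bar>f x\<bar> \<le> 1" "(1/2)-lipschitz_on UNIV f"
    "\<And>x. (F has_real_derivative f x) (at x)"
    "\<And>x. x \<ge> 0 \<Longrightarrow> x * f x - \<theta> * (F (x + 1) - F x) = h x - c"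
proof -
  have dh: "(h has_real_derivative deriv h x) (at x)" for x
    using h by (simp add: H11_def DERIV_deriv_iff_real_differentiable)
  have h1: "1-lipschitz_on UNIV h" "1-lipschitz_on UNIV (deriv h)" using h by (auto simp: H11_def)
  have bd: "\<bar>deriv h x\<bar> \<le> 1" for x
    by (rule lipschitz_on_UNIV_abs_deriv_le[OF h1(1) dh])
  from stein_fixed_point[OF \<theta> h1(2) bd] obtain f where
    f: "\<And>x. \<bar>f x\<bar> \<le> 1" "(1/2)-lipschitz_on UNIV f" "stein_op \<theta> (deriv h) f = f" by auto
  have fc: "continuous_on UNIV f" by (rule lipschitz_on_continuous_on[OF f(2)])
  from einterval_antiderivative[of "-\<infinity>" "\<infinity>" f] fc
  obtain F where F: "\<And>x. (F has_real_derivative f x) (at x)"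
    by (auto simp: continuous_on_eq_continuous_at has_real_derivative_iff_has_vector_derivative)
  have Fc: "continuous_on UNIV F"
    using F by (intro continuous_at_imp_continuous_on ballI DERIV_isCont)
  define K where "K = (\<lambda>x. x * f x - \<theta> * (F (x + 1) - F x) - h x)"
  have dF1: "((\<lambda>x. F (x + 1)) has_real_derivative f (x + 1)) (at x)" for x
    using F[of "x + 1"] by (simp add: DERIV_shift)
  have "(K has_real_derivative 0) (at x within {0<..})" if "x \<in> {0<..}" for x
  proof -
    have "(K has_real_derivative (deriv h x + \<theta> * f (x + 1) - \<theta> * f x) - \<theta> * (f (x + 1) - f x) - deriv h x) (at x)"
      unfolding K_def
      by (intro DERIV_diff DERIV_cmult stein_op_deriv[OF \<theta> h1(2) bd fc f(3)] dF1 F dh) (use that in auto)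
    thus ?thesis by (simp add: algebra_simps has_field_derivative_at_within)
  qed
  from has_field_derivative_zero_constant[OF _ this]
  obtain c where c: "\<And>x. x \<in> {0<..} \<Longrightarrow> K x = c" by auto
  have "K x = c" if "x \<ge> 0" for x
  proof (rule continuous_constant_on_closure[where f = K and S = "{0<..}"])
    show "continuous_on (closure {0<..}) K" unfolding K_def
      by (intro continuous_on_diff continuous_on_mult continuous_on_const continuous_on_id
           continuous_on_subset[OF fc] continuous_on_compose2[OF Fc] continuous_on_add
           continuous_on_subset[OF lipschitz_on_continuous_on[OF h1(1)]]) auto
  qed (use c that in auto)
  thus ?thesis using that[OF f(1,2) F, of "-c"] unfolding K_def by (simp add: algebra_simps)
qed

section \<open>The generalized Dickman distribution\<close>

lemma integral_uniform_01:
  fixes \<phi> :: "real \<Rightarrow> real"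
  assumes "continuous_on {0..1} \<phi>" "\<phi> \<in> borel_measurable borel"
  shows "(\<integral>u. \<phi> u \<partial>uniform_measure lborel {0..1}) = integral {0..1} \<phi>"
proof -
  have "uniform_measure lborel {0..1::real} = density lborel (\<lambda>x. ennreal (indicator {0..1} x))"
    unfolding uniform_measure_def by (intro density_cong) (auto simp: indicator_def)
  hence "(\<integral>u. \<phi> u \<partial>uniform_measure lborel {0..1}) = (LINT u:{0..1}|lborel. \<phi> u)"
    using assms(2) by (simp add: integral_density set_lebesgue_integral_def)
  also have "\<dots> = integral {0..1} \<phi>"
    by (intro set_borel_integral_eq_integral borel_integrable_atLeastAtMost' assms)
  finally show ?thesis .
qed

text \<open>The integrand is the derivative in u of \<open>u * g (u powr (1/\<theta>) * y)\<close>,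
  so only the endpoint u = 1 contributes. The power need not be differentiable at 0, hence the
  fundamental theorem with derivatives in the interior only.\<close>

lemma integral_dickman_step:
  fixes g g' :: "real \<Rightarrow> real"
  assumes \<theta>: "\<theta> > 0" and y: "y > 0"
    and g: "\<And>x. x \<ge> 0 \<Longrightarrow> (g has_real_derivative g' x) (at x)"
    and g': "continuous_on {0..} g'"
  shows "integral {0..1} (\<lambda>u. u powr (1/\<theta>) * y * g' (u powr (1/\<theta>) * y) / \<theta> + g (u powr (1/\<theta>) * y)) = g y"
proof -
  have gc: "continuous_on {0..} g"
    using g by (intro continuous_at_imp_continuous_on ballI DERIV_isCont) auto
  have pc: "continuous_on {0..1} (\<lambda>u. u powr (1/\<theta>) * y)"
    using \<theta> by (intro continuous_on_mult continuous_on_powr_Icc continuous_on_const) auto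
  have "((\<lambda>u. u powr (1/\<theta>) * y * g' (u powr (1/\<theta>) * y) / \<theta> + g (u powr (1/\<theta>) * y)) has_integral
     1 * g (1 powr (1/\<theta>) * y) - 0 * g (0 powr (1/\<theta>) * y)) {0..1}"
  proof (rule fundamental_theorem_of_calculus_interior)
    show "continuous_on {0..1} (\<lambda>u. u * g (u powr (1/\<theta>) * y))"
      using y by (intro continuous_on_mult continuous_on_id continuous_on_compose2[OF gc pc]) auto
    fix u :: real assume u: "u \<in> {0<..<1}"
    have "((\<lambda>u. u powr (1/\<theta>) * y) has_real_derivative (1/\<theta> * u powr (1/\<theta> - 1)) * y) (at u)"
      using u by (intro DERIV_cmult_right has_real_derivative_powr) auto
    from DERIV_chain2[OF g this] u y
    have "((\<lambda>u. g (u powr (1/\<theta>) * y)) has_real_derivative g' (u powr (1/\<theta>) * y) * ((1/\<theta> * u powr (1/\<theta> - 1)) * y)) (at u)"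
      by simp
    from DERIV_mult[OF DERIV_ident this]
    show "((\<lambda>u. u * g (u powr (1/\<theta>) * y)) has_vector_derivative u powr (1/\<theta>) * y * g' (u powr (1/\<theta>) * y) / \<theta> + g (u powr (1/\<theta>) * y)) (at u)"
      unfolding has_real_derivative_iff_has_vector_derivative[symmetric]
      by (rule DERIV_cong) (use u in \<open>auto simp: powr_diff field_simps\<close>)
  qed simp
  thus ?thesis by (simp add: integral_unique)
qed

text \<open>This is the Stein characterisation E[D g'(D)] = \<theta> E[g(D + 1) - g(D)]. The
  function x g'(x) / \<theta> + g(x) is chosen so that averaging over U alone, with D = x fixed,
  collapses to g(x + 1). Integrability is asked only of this combination, so the identity is
  available before D is known to have a mean.\<close>

lemma dickman_stein_identity:
  fixes g g' :: "real \<Rightarrow> real"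
  assumes \<theta>: "\<theta> > 0" and D: "is_dickman \<theta> D"
    and g: "\<And>x. x \<ge> 0 \<Longrightarrow> (g has_real_derivative g' x) (at x)"
    and g': "continuous_on {0..} g'"
    and [measurable]: "g \<in> borel_measurable borel" "g' \<in> borel_measurable borel"
    and int: "integrable D (\<lambda>x. x * g' x / \<theta> + g x)"
  shows "(\<integral>x. x * g' x / \<theta> + g x \<partial>D) = (\<integral>x. g (x + 1) \<partial>D)"
proof -
  define U where "U = uniform_measure lborel {0..1::real}"
  define \<Phi> where "\<Phi> = (\<lambda>x. x * g' x / \<theta> + g x)"
  define T where "T = (\<lambda>(u::real, x::real). u powr (1 / \<theta>) * (x + 1))"
  interpret D: prob_space D using D by (auto simp: is_dickman_def)
  interpret U: prob_space U unfolding U_def by (rule prob_space_uniform_measure) auto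
  interpret UD: pair_prob_space U D ..
  have [measurable_cong]: "sets D = sets borel" "sets U = sets borel"
    using D by (auto simp: is_dickman_def U_def)
  have nonneg: "AE x in D. 0 \<le> x" and eq: "distr (U \<Otimes>\<^sub>M D) borel T = D"
    using D by (auto simp: is_dickman_def U_def T_def)
  have [measurable]: "\<Phi> \<in> borel_measurable borel" "T \<in> borel_measurable (U \<Otimes>\<^sub>M D)"
    unfolding \<Phi>_def T_def by measurable
  have gc: "continuous_on {0..} g"
    using g by (intro continuous_at_imp_continuous_on ballI DERIV_isCont) auto
  have int': "integrable (U \<Otimes>\<^sub>M D) (\<lambda>z. \<Phi> (T z))"
    using int by (subst (asm) eq[symmetric]) (simp add: integrable_distr_eq \<Phi>_def[symmetric])
  have "(\<integral>x. \<Phi> x \<partial>D) = (\<integral>z. \<Phi> (T z) \<partial>(U \<Otimes>\<^sub>M D))"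
    by (subst eq[symmetric]) (simp add: integral_distr)
  also have "\<dots> = (\<integral>x. \<integral>u. \<Phi> (T (u, x)) \<partial>U \<partial>D)"
    using UD.integral_snd[of "\<lambda>u x. \<Phi> (T (u, x))"] int' by (simp add: case_prod_unfold)
  also have "\<dots> = (\<integral>x. g (x + 1) \<partial>D)"
  proof (rule integral_cong_AE)
    show "AE x in D. (\<integral>u. \<Phi> (T (u, x)) \<partial>U) = g (x + 1)" using nonneg
    proof eventually_elim
      case (elim x)
      have pc: "continuous_on {0..1} (\<lambda>u. u powr (1/\<theta>) * (x + 1))"
        using \<theta> by (intro continuous_on_mult continuous_on_powr_Icc continuous_on_const) auto
      have "continuous_on {0..1} (\<lambda>u. \<Phi> (T (u, x)))"
        unfolding \<Phi>_def T_def prod.case using elim \<theta>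
        by (intro continuous_on_add continuous_on_divide continuous_on_mult continuous_on_const
              continuous_on_compose2[OF gc pc] continuous_on_compose2[OF g' pc]
              continuous_on_powr_Icc) auto
      hence "(\<integral>u. \<Phi> (T (u, x)) \<partial>U) = integral {0..1} (\<lambda>u. \<Phi> (T (u, x)))"
        unfolding U_def by (rule integral_uniform_01) (simp add: T_def)
      also have "\<dots> = g (x + 1)"
        unfolding \<Phi>_def T_def prod.case using integral_dickman_step[OF \<theta> _ g g', of "x + 1"] elim
        by simp
      finally show ?case .
    qed
  qed simp_all
  finally show ?thesis by (simp add: \<Phi>_def)
qed

text \<open>Test functions \<open>g x = K * x / (K + x)\<close>: these are bounded, \<open>g (x + 1) - g x \<le> 1\<close>, and
  \<open>x * g' x\<close> tends to \<open>x\<close> as \<open>K\<close> grows, so Fatou's lemma bounds the mean by \<open>\<theta>\<close>.\<close>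

lemma dickman_integrable:
  assumes \<theta>: "\<theta> > 0" and D: "is_dickman \<theta> D"
  shows "integrable D (\<lambda>x. x)"
proof -
  interpret D: prob_space D using D by (auto simp: is_dickman_def)
  have [measurable_cong]: "sets D = sets borel"
    using D by (auto simp: is_dickman_def)
  have nonneg: "AE x in D. 0 \<le> x" using D by (auto simp: is_dickman_def)
  define q where "q = (\<lambda>(K::real) x::real. x * (K / (K + x))^2)"
  have [measurable]: "q K \<in> borel_measurable borel" for K unfolding q_def by measurable
  have main: "(\<integral>\<^sup>+x. ennreal (q K x) \<partial>D) \<le> ennreal \<theta>" if K: "K > 0" for K
  proof -
    define g where "g = (\<lambda>x. K * x / (K + x))"
    define g' where "g' = (\<lambda>x. (K / (K + x))^2)"
    have [measurable]: "g \<in> borel_measurable borel" "g' \<in> borel_measurable borel"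
      unfolding g_def g'_def by measurable
    have g: "(g has_real_derivative g' x) (at x)" if "x \<ge> 0" for x
      unfolding g_def g'_def
      by (rule derivative_eq_intros refl | use that K in \<open>simp add: field_simps power2_eq_square\<close>)+
    have g': "continuous_on {0..} g'" unfolding g'_def using K
      by (intro continuous_intros) auto
    have bd: "0 \<le> g x \<and> g x \<le> K \<and> 0 \<le> q K x \<and> q K x \<le> K" if "x \<ge> 0" for x
    proof -
      have 1: "0 \<le> g x" "g x \<le> K" unfolding g_def using that K by (auto simp: field_simps)
      have 2: "q K x = g x * (K / (K + x))" by (simp add: q_def g_def power2_eq_square)
      have "q K x \<le> K * 1" unfolding 2 using 1 that K by (intro mult_mono) auto
      moreover have "0 \<le> q K x" unfolding q_def using that by auto
      ultimately show ?thesis using 1 by auto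
    qed
    have "AE x in D. norm (g x) \<le> K" using nonneg by eventually_elim (use bd in auto)
    hence ig: "integrable D g" by (rule D.integrable_const_bound) simp
    have "AE x in D. norm (q K x) \<le> K" using nonneg by eventually_elim (use bd in auto)
    hence iq: "integrable D (q K)" by (rule D.integrable_const_bound) simp
    have ig1: "integrable D (\<lambda>x. g (x + 1))"
    proof (rule D.integrable_const_bound[where B=K])
      show "AE x in D. norm (g (x + 1)) \<le> K" using nonneg by eventually_elim (use bd in auto)
    qed simp
    have eq: "x * g' x / \<theta> + g x = q K x / \<theta> + g x" for x by (simp add: q_def g'_def)
    have "(\<integral>x. q K x / \<theta> + g x \<partial>D) = (\<integral>x. g (x + 1) \<partial>D)"
      using dickman_stein_identity[OF \<theta> D g g'] ig iq unfolding eq by simp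
    hence "(\<integral>x. q K x \<partial>D) = \<theta> * (\<integral>x. g (x + 1) - g x \<partial>D)"
      using ig iq ig1 \<theta> by (simp add: field_simps)
    also have "(\<integral>x. g (x + 1) - g x \<partial>D) \<le> (\<integral>x. 1 \<partial>D)"
    proof (rule integral_mono_AE)
      show "AE x in D. g (x + 1) - g x \<le> 1" using nonneg
      proof eventually_elim
        case (elim x)
        have "K + x \<noteq> 0" "K + x + 1 \<noteq> 0" using elim K by auto
        hence "g (x + 1) - g x = K / (K + x) * (K / (K + x + 1))"
          unfolding g_def by (simp add: divide_simps add.assoc) (simp add: algebra_simps)
        also have "\<dots> \<le> 1 * 1" using elim K by (intro mult_mono) auto
        finally show ?case by simp
      qed
    qed (use ig ig1 in auto)
    finally have "(\<integral>x. q K x \<partial>D) \<le> \<theta>" using \<theta> by (simp add: D.prob_space)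
    moreover have "AE x in D. 0 \<le> q K x" using nonneg by eventually_elim (use bd in auto)
    ultimately show ?thesis using iq by (simp add: nn_integral_eq_integral ennreal_leI)
  qed
  \<comment> \<open>The parameter runs through \<open>Suc m\<close> because the uniform bound
    \<open>main\<close> requires K > 0.\<close>
  have "(\<integral>\<^sup>+x. ennreal (norm x) \<partial>D) = (\<integral>\<^sup>+x. liminf (\<lambda>m. ennreal (q (real (Suc m)) x)) \<partial>D)"
  proof (rule nn_integral_cong_AE)
    show "AE x in D. ennreal (norm x) = liminf (\<lambda>m. ennreal (q (real (Suc m)) x))" using nonneg
    proof eventually_elim
      case (elim x)
      have "(\<lambda>m. q (real (Suc m)) x) \<longlonglongrightarrow> x"
      proof -
        have "(\<lambda>m. real (Suc m) / (real (Suc m) + x)) \<longlonglongrightarrow> 1" by real_asymp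
        from tendsto_mult[OF tendsto_const[of x] tendsto_power[OF this, of 2]]
        show ?thesis by (simp add: q_def)
      qed
      hence "(\<lambda>m. ennreal (q (real (Suc m)) x)) \<longlonglongrightarrow> ennreal x" by simp
      from lim_imp_Liminf[OF _ this] elim show ?case by simp
    qed
  qed
  also have "\<dots> \<le> liminf (\<lambda>m. \<integral>\<^sup>+x. ennreal (q (real (Suc m)) x) \<partial>D)"
    by (rule nn_integral_liminf) simp
  also have "\<dots> \<le> ennreal \<theta>"
    by (rule Liminf_le) (auto intro!: main always_eventually)
  finally show ?thesis by (intro integrableI_bounded) (auto intro: le_less_trans)
qed

lemma lipschitz_integrable:
  fixes h :: "real \<Rightarrow> real"
  assumes "C-lipschitz_on UNIV h" "finite_measure M" "integrable M X"
  shows "integrable M (\<lambda>x. h (X x))"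
proof (rule Bochner_Integration.integrable_bound)
  interpret finite_measure M by fact
  show "integrable M (\<lambda>x. \<bar>h 0\<bar> + C * \<bar>X x\<bar>)" using assms(3) by simp
  have "h \<in> borel_measurable borel"
    using lipschitz_on_continuous_on[OF assms(1)] by (rule borel_measurable_continuous_onI)
  thus "(\<lambda>x. h (X x)) \<in> borel_measurable M" using assms(3) by simp
  have "\<bar>h y\<bar> \<le> \<bar>h 0\<bar> + C * \<bar>y\<bar>" for y
    using lipschitz_onD[OF assms(1), of y 0] by (simp add: dist_real_def)
  thus "AE x in M. norm (h (X x)) \<le> norm (\<bar>h 0\<bar> + C * \<bar>X x\<bar>)"
    by (intro AE_I2) (force intro: order_trans abs_ge_self)
qed

lemma lipschitz_on_UNIV_deriv:
  fixes F f :: "real \<Rightarrow> real"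
  assumes "\<And>x. (F has_real_derivative f x) (at x)" "\<And>x. \<bar>f x\<bar> \<le> C"
  shows "C-lipschitz_on UNIV F"
proof (rule lipschitz_onI)
  show "dist (F x) (F y) \<le> C * dist x y" for x y
    using field_differentiable_bound[of UNIV F f C x y] assms by (simp add: dist_norm)
  show "0 \<le> C" by (rule order_trans[OF abs_ge_zero assms(2)])
qed

lemma stein_solution:
  assumes \<theta>: "\<theta> > 0" and D: "is_dickman \<theta> D" and h: "h \<in> H11"
  obtains f F where "\<And>x. \<bar>f x\<bar> \<le> 1" "(1/2)-lipschitz_on UNIV f"
    "\<And>x. (F has_real_derivative f x) (at x)"
    "\<And>x. x \<ge> 0 \<Longrightarrow> x * f x - \<theta> * (F (x + 1) - F x) = h x - (\<integral>x. h x \<partial>D)"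
proof -
  interpret D: prob_space D using D by (auto simp: is_dickman_def)
  have [measurable_cong]: "sets D = sets borel"
    using D by (auto simp: is_dickman_def)
  have nonneg: "AE x in D. 0 \<le> x" using D by (auto simp: is_dickman_def)
  obtain f F c where f: "\<And>x. \<bar>f x\<bar> \<le> 1" "(1/2)-lipschitz_on UNIV f"
    and F: "\<And>x. (F has_real_derivative f x) (at x)"
    and eq: "\<And>x. x \<ge> 0 \<Longrightarrow> x * f x - \<theta> * (F (x + 1) - F x) = h x - c"
    using stein_solution_const[OF \<theta> h] by metis
  have fc: "continuous_on UNIV f" by (rule lipschitz_on_continuous_on[OF f(2)])
  have F_lip: "1-lipschitz_on UNIV F" by (rule lipschitz_on_UNIV_deriv[OF F f(1)])
  have Fc: "continuous_on UNIV F" by (rule lipschitz_on_continuous_on[OF F_lip])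
  have [measurable]: "f \<in> borel_measurable borel" "F \<in> borel_measurable borel"
    using fc Fc by (auto intro: borel_measurable_continuous_onI)
  have id: "integrable D (\<lambda>x. x)" by (rule dickman_integrable[OF \<theta> D])
  have iF: "integrable D F" "integrable D (\<lambda>x. F (x + 1))"
    using lipschitz_integrable[OF F_lip D.finite_measure_axioms, of "\<lambda>x. x"]
      lipschitz_integrable[OF F_lip D.finite_measure_axioms, of "\<lambda>x. x + 1"] id by auto
  have "integrable D (\<lambda>x. x * f x)"
    by (rule Bochner_Integration.integrable_bound[OF id])
       (use f(1) in \<open>auto simp: abs_mult intro!: mult_left_le\<close>)
  note int = this iF
  have hm: "h \<in> borel_measurable borel"
    using h by (auto simp: H11_def intro!: borel_measurable_continuous_onI lipschitz_on_continuous_on)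
  have ih: "integrable D h"
    using h lipschitz_integrable[OF _ D.finite_measure_axioms id, of 1 h] by (auto simp: H11_def)
  \<comment> \<open>With g = \<theta> F the term x g'(x) / \<theta> is x f(x), so the identity says
    that the left-hand side of the Stein equation has mean zero under D; this determines
    \<open>c\<close>.\<close>
  have "(\<integral>x. x * (\<theta> * f x) / \<theta> + \<theta> * F x \<partial>D) = (\<integral>x. \<theta> * F (x + 1) \<partial>D)"
  proof (rule dickman_stein_identity[OF \<theta> D])
    show "((\<lambda>x. \<theta> * F x) has_real_derivative \<theta> * f x) (at x)" for x
      by (intro DERIV_cmult F)
    show "continuous_on {0..} (\<lambda>x. \<theta> * f x)"
      by (intro continuous_on_mult continuous_on_const continuous_on_subset[OF fc]) simp
  qed (use \<theta> int in simp_all)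
  hence "(\<integral>x. x * f x - \<theta> * (F (x + 1) - F x) \<partial>D) = 0"
    using \<theta> int by (simp add: algebra_simps)
  also have "(\<integral>x. x * f x - \<theta> * (F (x + 1) - F x) \<partial>D) = (\<integral>x. h x - c \<partial>D)"
    by (rule integral_cong_AE) (use nonneg eq hm in auto)
  also have "\<dots> = (\<integral>x. h x \<partial>D) - c" using ih by (simp add: D.prob_space)
  finally show ?thesis using that[OF f F] eq by simp
qed

section \<open>Deterministic weights\<close>

text \<open>As f is only Lipschitz, no second-order expansion is available. Instead
  \<open>F u - u * f b\<close> becomes monotone in u once C/2 (b - u)^2 is subtracted or added,
  which gives one sign of the error each. The right endpoint is the one at which the grid sum
  evaluates f.\<close>

lemma endpoint_rule_error:
  fixes F f :: "real \<Rightarrow> real"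
  assumes F: "\<And>x. (F has_real_derivative f x) (at x)" and lip: "C-lipschitz_on UNIV f" and ab: "a \<le> b"
  shows "\<bar>F b - F a - (b - a) * f b\<bar> \<le> C / 2 * (b - a)^2"
proof -
  have f: "\<bar>f u - f b\<bar> \<le> C * (b - u)" if "u \<le> b" for u
    using lipschitz_onD[OF lip, of u b] that by (simp add: dist_real_def)
  have "F a - a * f b - C / 2 * (b - a)^2 \<le> F b - b * f b - C / 2 * (b - b)^2"
  proof (rule DERIV_nonneg_imp_nondecreasing[OF ab])
    fix u assume u: "a \<le> u" "u \<le> b"
    have "((\<lambda>u. F u - u * f b - C / 2 * (b - u)^2) has_real_derivative f u - f b + C * (b - u)) (at u)"
      by (auto intro!: derivative_eq_intros F simp: field_simps)
    moreover have "0 \<le> f u - f b + C * (b - u)" using f[OF u(2)] by linarith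
    ultimately show "\<exists>y. ((\<lambda>u. F u - u * f b - C / 2 * (b - u)^2) has_real_derivative y) (at u) \<and> 0 \<le> y"
      by blast
  qed
  moreover have "F b - b * f b + C / 2 * (b - b)^2 \<le> F a - a * f b + C / 2 * (b - a)^2"
  proof (rule DERIV_nonpos_imp_nonincreasing[OF ab])
    fix u assume u: "a \<le> u" "u \<le> b"
    have "((\<lambda>u. F u - u * f b + C / 2 * (b - u)^2) has_real_derivative f u - f b - C * (b - u)) (at u)"
      by (auto intro!: derivative_eq_intros F simp: field_simps)
    moreover have "f u - f b - C * (b - u) \<le> 0" using f[OF u(2)] by linarith
    ultimately show "\<exists>y. ((\<lambda>u. F u - u * f b + C / 2 * (b - u)^2) has_real_derivative y) (at u) \<and> y \<le> 0"
      by blast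
  qed
  ultimately have "\<bar>(F b - b * f b) - (F a - a * f b)\<bar> \<le> C / 2 * (b - a)^2"
    unfolding abs_le_iff by simp
  thus ?thesis by (simp add: algebra_simps)
qed

lemma grid_nonneg:
  fixes t :: "nat \<Rightarrow> real"
  assumes "t 0 = 0" "\<And>k. k \<in> {1..n} \<Longrightarrow> t (k - 1) \<le> t k" "m \<le> n"
  shows "0 \<le> t m"
  using assms(3) by (induction m) (use assms(1) assms(2)[of "Suc _"] in \<open>auto intro: order_trans\<close>)

lemma grid_mesh_ge: "k \<in> {1..n} \<Longrightarrow> t k - t (k - 1) \<le> grid_mesh n t"
  unfolding grid_mesh_def by (intro Max_ge) auto

lemma grid_dev_max_ge: "k \<in> {1..n} \<Longrightarrow> \<bar>grid_dev \<theta> w lam t k\<bar> \<le> grid_dev_max \<theta> n w lam t"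
  unfolding grid_dev_max_def by (intro Max_ge) auto

lemma grid_mesh_nonneg:
  assumes "n \<ge> 1" "\<And>k. k \<in> {1..n} \<Longrightarrow> t (k - 1) \<le> t k"
  shows "0 \<le> grid_mesh n t"
  using grid_mesh_ge[of 1 n t] assms(2)[of 1] assms(1) by simp

lemma grid_dev_max_nonneg: "n \<ge> 1 \<Longrightarrow> 0 \<le> grid_dev_max \<theta> n w lam t"
  using grid_dev_max_ge[of 1 n \<theta> w lam t] by auto

context
  fixes \<theta> s :: real and n :: nat and w lam t :: "nat \<Rightarrow> real" and f F :: "real \<Rightarrow> real"
  assumes \<theta>: "\<theta> > 0" and n: "n \<ge> 1"
    and w: "\<And>k. k \<in> {1..n} \<Longrightarrow> w k \<ge> 0" and lam: "\<And>k. k \<in> {1..n} \<Longrightarrow> lam k \<ge> 0"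
    and t0: "t 0 = 0" and t_mono: "\<And>k. k \<in> {1..n} \<Longrightarrow> t (k - 1) \<le> t k"
    and f_bd: "\<And>x. \<bar>f x\<bar> \<le> 1" and f_lip: "(1/2)-lipschitz_on UNIV f"
    and F: "\<And>x. (F has_real_derivative f x) (at x)"
begin

lemma f_lipD: "\<bar>f x - f y\<bar> \<le> 1/2 * \<bar>x - y\<bar>"
  using lipschitz_onD[OF f_lip, of x y] by (simp add: dist_real_def)

text \<open>A cell of width d costs d^2 / 4, since f has Lipschitz constant 1/2. This is at most d /
  4 times the mesh, and the widths add up to \<open>t m\<close>.\<close>

lemma riemann_sum_error:
  "m \<le> n \<Longrightarrow> \<bar>(F (s + t m) - F s) - (\<Sum>k=1..m. (t k - t (k - 1)) * f (s + t k))\<bar> \<le> grid_mesh n t * t m / 4"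
proof (induction m)
  case 0
  show ?case by (simp add: t0)
next
  case (Suc m)
  let ?d = "t (Suc m) - t m"
  have d: "0 \<le> ?d" "?d \<le> grid_mesh n t"
    using t_mono[of "Suc m"] grid_mesh_ge[of "Suc m" n t] Suc.prems by auto
  have "\<bar>F (s + t (Suc m)) - F (s + t m) - ?d * f (s + t (Suc m))\<bar> \<le> ?d^2 / 4"
    using endpoint_rule_error[OF F f_lip, of "s + t m" "s + t (Suc m)"] d(1) by simp
  also have "?d^2 / 4 \<le> grid_mesh n t * ?d / 4"
    using d unfolding power2_eq_square by (intro divide_right_mono mult_right_mono) auto
  finally have "\<bar>F (s + t (Suc m)) - F (s + t m) - ?d * f (s + t (Suc m))\<bar> \<le> grid_mesh n t * ?d / 4" .
  moreover have "\<bar>F (s + t m) - F s - (\<Sum>k=1..m. (t k - t (k - 1)) * f (s + t k))\<bar> \<le> grid_mesh n t * t m / 4"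
    using Suc by simp
  moreover have "F (s + t (Suc m)) - F s - (\<Sum>k=1..Suc m. (t k - t (k - 1)) * f (s + t k)) =
    (F (s + t m) - F s - (\<Sum>k=1..m. (t k - t (k - 1)) * f (s + t k)))
    + (F (s + t (Suc m)) - F (s + t m) - ?d * f (s + t (Suc m)))"
    by simp
  moreover have "grid_mesh n t * t (Suc m) / 4 = grid_mesh n t * t m / 4 + grid_mesh n t * ?d / 4"
    by (simp add: right_diff_distrib diff_divide_distrib)
  ultimately show ?case by linarith
qed

text \<open>Once the boundary term is removed, summation by parts pairs each partial deviation with
  an increment of f, and f moves by at most half a grid step. The induction carries out the shift of
  indices.\<close>

lemma abel_summation_error:
  "m \<le> n \<Longrightarrow> \<bar>(\<Sum>k=1..m. (lam k * w k - \<theta> * (t k - t (k - 1))) * f (s + t k))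
       - grid_dev \<theta> w lam t m * f (s + t m)\<bar> \<le> grid_dev_max \<theta> n w lam t * t m / 2"
proof (induction m)
  case 0
  show ?case by (simp add: t0 grid_dev_def)
next
  case (Suc m)
  let ?D = "grid_dev \<theta> w lam t" and ?M = "grid_dev_max \<theta> n w lam t"
  have step: "?D (Suc m) = ?D m + (lam (Suc m) * w (Suc m) - \<theta> * (t (Suc m) - t m))"
    by (simp add: grid_dev_def)
  \<comment> \<open>The maximum ranges over indices from 1 on; at index 0 the deviation is an empty
    sum.\<close>
  have "\<bar>?D m\<bar> \<le> ?M"
    using grid_dev_max_ge[of m n \<theta> w lam t] grid_dev_max_nonneg[OF n, of \<theta> w lam t] Suc.prems by (cases "m = 0") (auto simp: grid_dev_def)
  moreover have "\<bar>f (s + t (Suc m)) - f (s + t m)\<bar> \<le> (t (Suc m) - t m) / 2"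
    using f_lipD[of "s + t (Suc m)" "s + t m"] t_mono[of "Suc m"] Suc.prems by simp
  ultimately have "\<bar>?D m * (f (s + t (Suc m)) - f (s + t m))\<bar> \<le> ?M * ((t (Suc m) - t m) / 2)"
    unfolding abs_mult using grid_dev_max_nonneg[OF n] by (intro mult_mono) auto
  moreover have "(\<Sum>k=1..Suc m. (lam k * w k - \<theta> * (t k - t (k - 1))) * f (s + t k)) - ?D (Suc m) * f (s + t (Suc m)) =
     ((\<Sum>k=1..m. (lam k * w k - \<theta> * (t k - t (k - 1))) * f (s + t k)) - ?D m * f (s + t m))
      - ?D m * (f (s + t (Suc m)) - f (s + t m))"
    by (simp add: step algebra_simps)
  moreover have "\<bar>(\<Sum>k=1..m. (lam k * w k - \<theta> * (t k - t (k - 1))) * f (s + t k)) - ?D m * f (s + t m)\<bar> \<le> ?M * t m / 2"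
    using Suc by simp
  moreover have "?M * t (Suc m) / 2 = ?M * t m / 2 + ?M * ((t (Suc m) - t m) / 2)"
    by (simp add: right_diff_distrib diff_divide_distrib)
  ultimately show ?case by linarith
qed

text \<open>Each replacement costs one term. \<open>R\<close> moves the argument from
  \<open>w k\<close> to \<open>t k\<close>. Summation by parts yields the share
  \<open>t n / 2\<close> of the maximal deviation, and its boundary term, with |f| \<le> 1, the
  share 1. The Riemann sum yields the mesh term, and moving the upper limit from \<open>t n\<close>
  to 1 the last one, because F has slope at most 1.\<close>

lemma grid_stein_error:
  "\<bar>(\<Sum>k=1..n. lam k * w k * f (s + w k)) - \<theta> * (F (s + 1) - F s)\<bar> \<le>
     \<theta> * t n / 4 * grid_mesh n t + (1 + t n / 2) * grid_dev_max \<theta> n w lam t + \<theta> * \<bar>t n - 1\<bar>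
     + 1/2 * (\<Sum>k=1..n. lam k * w k * \<bar>w k - t k\<bar>)"
proof -
  let ?M = "grid_dev_max \<theta> n w lam t" and ?D = "grid_dev \<theta> w lam t n"
  define S where "S = (\<Sum>k=1..n. (t k - t (k - 1)) * f (s + t k))"
  define T where "T = (\<Sum>k=1..n. (lam k * w k - \<theta> * (t k - t (k - 1))) * f (s + t k))"
  define R where "R = (\<Sum>k=1..n. lam k * w k * (f (s + w k) - f (s + t k)))"
  have "\<bar>R\<bar> \<le> (\<Sum>k=1..n. lam k * w k * (1/2 * \<bar>w k - t k\<bar>))"
    unfolding R_def
  proof (rule order_trans[OF sum_abs], rule sum_mono)
    fix k assume k: "k \<in> {1..n}"
    show "\<bar>lam k * w k * (f (s + w k) - f (s + t k))\<bar> \<le> lam k * w k * (1/2 * \<bar>w k - t k\<bar>)"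
      using mult_left_mono[OF f_lipD[of "s + w k" "s + t k"], of "lam k * w k"] w[OF k] lam[OF k]
      by (simp add: abs_mult)
  qed
  also have "\<dots> = 1/2 * (\<Sum>k=1..n. lam k * w k * \<bar>w k - t k\<bar>)"
    by (simp add: sum_distrib_left mult_ac)
  finally have 1: "\<bar>R\<bar> \<le> 1/2 * (\<Sum>k=1..n. lam k * w k * \<bar>w k - t k\<bar>)" .
  have 2: "\<bar>T - ?D * f (s + t n)\<bar> \<le> ?M * t n / 2"
    using abel_summation_error[of n] by (simp add: T_def)
  have "\<bar>?D * f (s + t n)\<bar> \<le> ?M * 1"
    unfolding abs_mult using grid_dev_max_ge[of n n \<theta> w lam t] n grid_dev_max_nonneg[OF n, of \<theta> w lam t] f_bd by (intro mult_mono) auto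
  hence 3: "\<bar>?D * f (s + t n)\<bar> \<le> ?M" by simp
  have "\<bar>\<theta> * S - \<theta> * (F (s + t n) - F s)\<bar> = \<theta> * \<bar>(F (s + t n) - F s) - S\<bar>"
    using \<theta> by (simp add: abs_minus_commute abs_mult flip: right_diff_distrib)
  also have "\<dots> \<le> \<theta> * (grid_mesh n t * t n / 4)"
    using riemann_sum_error[of n] \<theta> by (intro mult_left_mono) (auto simp: S_def)
  finally have 4: "\<bar>\<theta> * S - \<theta> * (F (s + t n) - F s)\<bar> \<le> \<theta> * t n / 4 * grid_mesh n t"
    by (simp add: mult_ac)
  have "\<bar>F (s + t n) - F (s + 1)\<bar> \<le> 1 * \<bar>t n - 1\<bar>"
    using lipschitz_onD[OF lipschitz_on_UNIV_deriv[OF F f_bd], of "s + t n" "s + 1"]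
    by (simp add: dist_real_def)
  hence "\<theta> * \<bar>F (s + t n) - F (s + 1)\<bar> \<le> \<theta> * \<bar>t n - 1\<bar>" using \<theta> by simp
  hence 5: "\<bar>\<theta> * (F (s + t n) - F (s + 1))\<bar> \<le> \<theta> * \<bar>t n - 1\<bar>" using \<theta> by (simp add: abs_mult)
  have "(\<Sum>k=1..n. lam k * w k * f (s + w k)) = R + T + \<theta> * S"
    unfolding R_def T_def S_def sum_distrib_left
    by (simp add: algebra_simps flip: sum.distrib)
  hence "(\<Sum>k=1..n. lam k * w k * f (s + w k)) - \<theta> * (F (s + 1) - F s) =
     R + (T - ?D * f (s + t n)) + ?D * f (s + t n) + (\<theta> * S - \<theta> * (F (s + t n) - F s)) + \<theta> * (F (s + t n) - F (s + 1))"
    by (simp add: algebra_simps)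
  moreover have "(1 + t n / 2) * ?M = ?M + ?M * t n / 2" by (simp add: algebra_simps)
  ultimately show ?thesis using 1 2 3 4 5 by linarith
qed

end

section \<open>Size bias and the Wasserstein error under a product law\<close>

text \<open>Disintegration comes naturally for nonnegative integrands, so positive and negative
  parts are treated apart; as both outer integrals are finite, so are the inner ones almost
  everywhere. The bound \<open>c\<close> is an arbitrary function, as the error term to be inserted
  need not be visibly measurable. The lemma serves both for resampling one coordinate and for
  conditioning on the weights.\<close>

lemma abs_integral_disintegration_le:
  fixes f :: "'a \<Rightarrow> real" and g :: "'b \<Rightarrow> 'c \<Rightarrow> real" and K :: "'b \<Rightarrow> 'c measure"
  assumes f: "integrable M f"
    and g: "\<And>\<omega>. g \<omega> \<in> borel_measurable (K \<omega>)"
    and [measurable]: "(\<lambda>\<omega>. \<integral>\<^sup>+ x. ennreal (g \<omega> x) \<partial>K \<omega>) \<in> borel_measurable N"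
      "(\<lambda>\<omega>. \<integral>\<^sup>+ x. ennreal (- g \<omega> x) \<partial>K \<omega>) \<in> borel_measurable N"
    and pos: "(\<integral>\<^sup>+ x. ennreal (f x) \<partial>M) = (\<integral>\<^sup>+ \<omega>. \<integral>\<^sup>+ x. ennreal (g \<omega> x) \<partial>K \<omega> \<partial>N)"
    and neg: "(\<integral>\<^sup>+ x. ennreal (- f x) \<partial>M) = (\<integral>\<^sup>+ \<omega>. \<integral>\<^sup>+ x. ennreal (- g \<omega> x) \<partial>K \<omega> \<partial>N)"
    and c: "AE \<omega> in N. integrable (K \<omega>) (g \<omega>) \<longrightarrow> ennreal \<bar>\<integral> x. g \<omega> x \<partial>K \<omega>\<bar> \<le> c \<omega>"
  shows "ennreal \<bar>\<integral> x. f x \<partial>M\<bar> \<le> (\<integral>\<^sup>+ \<omega>. c \<omega> \<partial>N)"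
proof -
  define a where "a = (\<lambda>\<omega>. \<integral>\<^sup>+ x. ennreal (g \<omega> x) \<partial>K \<omega>)"
  define b where "b = (\<lambda>\<omega>. \<integral>\<^sup>+ x. ennreal (- g \<omega> x) \<partial>K \<omega>)"
  have [measurable]: "a \<in> borel_measurable N" "b \<in> borel_measurable N"
    unfolding a_def b_def by measurable
  have fin: "(\<integral>\<^sup>+ \<omega>. a \<omega> \<partial>N) \<noteq> \<infinity>" "(\<integral>\<^sup>+ \<omega>. b \<omega> \<partial>N) \<noteq> \<infinity>"
    using f unfolding a_def b_def pos[symmetric] neg[symmetric] real_integrable_def by auto
  have ae: "AE \<omega> in N. a \<omega> \<noteq> \<infinity>" "AE \<omega> in N. b \<omega> \<noteq> \<infinity>"
    by (intro nn_integral_PInf_AE fin; measurable)+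
  have ia: "integrable N (\<lambda>\<omega>. enn2real (a \<omega>))" "(\<integral>\<omega>. enn2real (a \<omega>) \<partial>N) = enn2real (\<integral>\<^sup>+ \<omega>. a \<omega> \<partial>N)"
    if [measurable]: "a \<in> borel_measurable N" and "(\<integral>\<^sup>+ \<omega>. a \<omega> \<partial>N) \<noteq> \<infinity>" "AE \<omega> in N. a \<omega> \<noteq> \<infinity>" for a
  proof -
    have eq: "(\<integral>\<^sup>+ \<omega>. ennreal (enn2real (a \<omega>)) \<partial>N) = (\<integral>\<^sup>+ \<omega>. a \<omega> \<partial>N)"
      by (rule nn_integral_cong_AE) (use that(3) in \<open>eventually_elim, simp add: less_top\<close>)
    show "integrable N (\<lambda>\<omega>. enn2real (a \<omega>))"
      using that by (intro integrableI_bounded) (auto simp: eq less_top)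
    show "(\<integral>\<omega>. enn2real (a \<omega>) \<partial>N) = enn2real (\<integral>\<^sup>+ \<omega>. a \<omega> \<partial>N)"
      by (subst integral_eq_nn_integral) (auto simp: eq)
  qed
  note ia = ia[of a] ia[of b]
  have "(\<integral> x. f x \<partial>M) = (\<integral>\<omega>. enn2real (a \<omega>) - enn2real (b \<omega>) \<partial>N)"
    using ia fin ae f unfolding real_lebesgue_integral_def[OF f] pos neg a_def[symmetric] b_def[symmetric]
    by simp
  also have "ennreal \<bar>\<dots>\<bar> \<le> (\<integral>\<^sup>+ \<omega>. ennreal \<bar>enn2real (a \<omega>) - enn2real (b \<omega>)\<bar> \<partial>N)"
    using integral_norm_bound_ennreal[of N "\<lambda>\<omega>. enn2real (a \<omega>) - enn2real (b \<omega>)"] ia fin ae by simp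
  also have "\<dots> \<le> (\<integral>\<^sup>+ \<omega>. c \<omega> \<partial>N)"
  proof (rule nn_integral_mono_AE)
    show "AE \<omega> in N. ennreal \<bar>enn2real (a \<omega>) - enn2real (b \<omega>)\<bar> \<le> c \<omega>"
      using ae c
    proof eventually_elim
      case (elim \<omega>)
      hence int: "integrable (K \<omega>) (g \<omega>)" using g by (simp add: real_integrable_def a_def b_def)
      with elim(3) show ?case by (simp add: real_lebesgue_integral_def[OF int] a_def b_def)
    qed
  qed
  finally show ?thesis .
qed

text \<open>The easy half of Kantorovich-Rubinstein duality, valid for each coupling separately.
  Boundedness of g replaces moment conditions: a size-biased law may have infinite mean when the
  second moment of the original one is infinite.\<close>

lemma wasserstein1_lower:
  assumes lip: "1-lipschitz_on UNIV g" and bd: "\<And>x. \<bar>g x\<bar> \<le> B"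
  shows "ennreal \<bar>(\<integral>x. g x \<partial>\<mu>) - (\<integral>x. g x \<partial>\<nu>)\<bar> \<le> wasserstein1 \<mu> \<nu>"
  unfolding wasserstein1_def
proof (rule INF_greatest)
  fix \<gamma> assume "\<gamma> \<in> couplings \<mu> \<nu>"
  hence ps: "prob_space \<gamma>" and [measurable_cong]: "sets \<gamma> = sets (borel \<Otimes>\<^sub>M borel)"
    and eq: "\<mu> = distr \<gamma> borel fst" "\<nu> = distr \<gamma> borel snd"
    by (auto simp: couplings_def)
  interpret prob_space \<gamma> by fact
  have [measurable]: "g \<in> borel_measurable borel"
    using lipschitz_on_continuous_on[OF lip] by (rule borel_measurable_continuous_onI)
  have int: "integrable \<gamma> (\<lambda>z. g (fst z))" "integrable \<gamma> (\<lambda>z. g (snd z))"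
    using bd by (intro integrable_const_bound[where B=B]; simp)+
  have "(\<integral>x. g x \<partial>\<mu>) - (\<integral>x. g x \<partial>\<nu>) = (\<integral>z. g (fst z) - g (snd z) \<partial>\<gamma>)"
    unfolding eq using int by (simp add: integral_distr)
  also have "ennreal \<bar>\<dots>\<bar> \<le> (\<integral>\<^sup>+ z. ennreal \<bar>g (fst z) - g (snd z)\<bar> \<partial>\<gamma>)"
    using integral_norm_bound_ennreal[of \<gamma> "\<lambda>z. g (fst z) - g (snd z)"] int by simp
  also have "\<dots> \<le> (\<integral>\<^sup>+ z. ennreal \<bar>fst z - snd z\<bar> \<partial>\<gamma>)"
    using lipschitz_onD[OF lip] by (intro nn_integral_mono ennreal_leI) (simp add: dist_real_def)
  finally show "ennreal \<bar>(\<integral>x. g x \<partial>\<mu>) - (\<integral>x. g x \<partial>\<nu>)\<bar> \<le> (\<integral>\<^sup>+ z. ennreal \<bar>fst z - snd z\<bar> \<partial>\<gamma>)" .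
qed

lemma integral_real_law: "g \<in> borel_measurable borel \<Longrightarrow> (\<integral>x. g x \<partial>real_law p) = measure_pmf.expectation p (\<lambda>x. g (real x))"
  for g :: "real \<Rightarrow> real"
  unfolding real_law_def by (subst integral_distr) auto

text \<open>With the other summands frozen in \<open>c\<close>, adding \<open>w\<close> to the sum
  is the same as adding one to the variable. Size biasing therefore compares the size-biased
  variable with the variable plus one, under the same function y \<mapsto> f(c + w y). The weight is
  \<open>lam * w\<close> from size biasing times the Lipschitz constant w/2 of that
  function.\<close>

lemma size_bias_error:
  fixes f :: "real \<Rightarrow> real"
  assumes f_bd: "\<And>x. \<bar>f x\<bar> \<le> 1" and f_lip: "(1/2)-lipschitz_on UNIV f"
    and p: "integrable (measure_pmf p) real" and sb: "is_size_biased p q" and w: "w \<ge> 0"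
    and lam: "lam = measure_pmf.expectation p real"
  shows "ennreal \<bar>measure_pmf.expectation p (\<lambda>x. w * real x * f (c + w * real x) - lam * w * f (c + w * real x + w))\<bar>
    \<le> ennreal (1/2) * (ennreal (lam * w) * (ennreal w * wasserstein1 (real_law q) (real_law (map_pmf Suc p))))"
    (is "ennreal \<bar>?L\<bar> \<le> _ * (_ * (_ * ?W))")
proof (cases "w = 0")
  case False
  with w have w: "w > 0" by simp
  \<comment> \<open>Dividing by \<open>w / 2\<close> normalises the Lipschitz constant to 1. This is
    why w = 0 is split off; there both sides vanish.\<close>
  define g where "g = (\<lambda>y. f (c + w * y) / (w / 2))"
  have g_lip: "1-lipschitz_on UNIV g"
  proof (rule lipschitz_onI)
    fix x y
    have "\<bar>f (c + w * x) - f (c + w * y)\<bar> \<le> 1/2 * \<bar>w * x - w * y\<bar>"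
      using lipschitz_onD[OF f_lip, of "c + w * x" "c + w * y"] by (simp add: dist_real_def)
    also have "\<dots> = w / 2 * \<bar>x - y\<bar>" using w by (simp add: abs_mult flip: right_diff_distrib)
    finally have "\<bar>f (c + w * x) - f (c + w * y)\<bar> / (w / 2) \<le> \<bar>x - y\<bar>"
      using w by (simp add: field_simps)
    thus "dist (g x) (g y) \<le> 1 * dist x y"
      using w unfolding g_def dist_real_def diff_divide_distrib[symmetric] abs_divide by simp
  qed simp
  have g_bd: "\<bar>g y\<bar> \<le> 2 / w" for y
    using f_bd[of "c + w * y"] w by (simp add: g_def abs_divide divide_right_mono)
  have gm: "g \<in> borel_measurable borel"
    using lipschitz_on_continuous_on[OF g_lip] by (rule borel_measurable_continuous_onI)
  have ig: "integrable (measure_pmf r) (\<lambda>x. g (u x))" for r and u :: "nat \<Rightarrow> real"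
    using g_bd by (intro measure_pmf.integrable_const_bound[where B="2/w"]) auto
  have ixg: "integrable (measure_pmf p) (\<lambda>x. real x * g (real x))"
  proof (rule Bochner_Integration.integrable_bound)
    show "integrable (measure_pmf p) (\<lambda>x. real x * (2/w))" using p by simp
    show "AE x in measure_pmf p. norm (real x * g (real x)) \<le> norm (real x * (2/w))"
      unfolding norm_mult using g_bd w by (intro AE_I2 mult_left_mono) (auto intro: order_trans[OF _ abs_ge_self])
  qed simp
  have "?L = measure_pmf.expectation p (\<lambda>x. w * (w / 2) * (real x * g (real x)) - lam * w * (w / 2) * g (real (Suc x)))"
    using w by (intro Bochner_Integration.integral_cong refl) (simp add: g_def algebra_simps)
  also have "\<dots> = w * (w / 2) * measure_pmf.expectation p (\<lambda>x. real x * g (real x)) -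
      lam * w * (w / 2) * measure_pmf.expectation p (\<lambda>x. g (real (Suc x)))"
    using ixg ig[of p "\<lambda>x. real (Suc x)"]
    by (subst Bochner_Integration.integral_diff) (simp_all del: of_nat_Suc)
  also have "measure_pmf.expectation p (\<lambda>x. real x * g (real x)) = lam * measure_pmf.expectation q (\<lambda>x. g (real x))"
    unfolding lam
    by (rule sb[unfolded is_size_biased_def, rule_format, where f = "\<lambda>x. g (real x)", OF ixg ig])
  also have "w * (w / 2) * (lam * measure_pmf.expectation q (\<lambda>x. g (real x))) -
      lam * w * (w / 2) * measure_pmf.expectation p (\<lambda>x. g (real (Suc x))) =
      (1/2 * (lam * w * w)) * ((\<integral>x. g x \<partial>real_law q) - (\<integral>x. g x \<partial>real_law (map_pmf Suc p)))"
    unfolding integral_real_law[OF gm] integral_map_pmf by (simp only: algebra_simps)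
  finally have L: "?L = (1/2 * (lam * w * w)) * ((\<integral>x. g x \<partial>real_law q) - (\<integral>x. g x \<partial>real_law (map_pmf Suc p)))" .
  have lam0: "lam \<ge> 0" unfolding lam by (intro integral_nonneg_AE) auto
  have "ennreal \<bar>?L\<bar> = ennreal (1/2 * (lam * w * w)) *
    ennreal \<bar>(\<integral>x. g x \<partial>real_law q) - (\<integral>x. g x \<partial>real_law (map_pmf Suc p))\<bar>"
    unfolding L abs_mult using lam0 w by (subst ennreal_mult[symmetric]) auto
  also have "\<dots> \<le> ennreal (1/2 * (lam * w * w)) * ?W"
    by (intro mult_left_mono wasserstein1_lower[OF g_lip g_bd]) simp
  also have "ennreal (1/2 * (lam * w * w)) = ennreal (1/2) * (ennreal (lam * w) * ennreal w)"
    using lam0 w by (simp only: ennreal_mult mult_nonneg_nonneg less_imp_le zero_le_divide_1_iff zero_le_numeral)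
  finally show ?thesis by (simp only: mult.assoc)
qed simp

lemma nn_integral_Pi_pmf_component:
  assumes "finite I" "k \<in> I"
  shows "(\<integral>\<^sup>+ x. \<phi> x \<partial>measure_pmf (Pi_pmf I dflt p)) =
    (\<integral>\<^sup>+ y. \<integral>\<^sup>+ z. \<phi> (y(k := z)) \<partial>measure_pmf (p k) \<partial>measure_pmf (Pi_pmf (I - {k}) dflt p))"
proof -
  have "Pi_pmf I dflt p = map_pmf (\<lambda>(y, f). f(k := y)) (pair_pmf (p k) (Pi_pmf (I - {k}) dflt p))"
    using Pi_pmf_insert[of "I - {k}" k dflt p] assms by (simp add: insert_absorb)
  also have "\<dots> = map_pmf (\<lambda>(f, y). f(k := y)) (pair_pmf (Pi_pmf (I - {k}) dflt p) (p k))"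
    by (subst pair_commute_pmf) (simp add: pmf.map_comp o_def case_prod_unfold)
  finally show ?thesis by (simp add: nn_integral_pair_pmf')
qed

lemma integrable_Pi_pmf_component:
  fixes \<phi> :: "'b \<Rightarrow> real"
  assumes "finite I" "k \<in> I" "integrable (measure_pmf (p k)) \<phi>"
  shows "integrable (measure_pmf (Pi_pmf I dflt p)) (\<lambda>x. \<phi> (x k))"
    "measure_pmf.expectation (Pi_pmf I dflt p) (\<lambda>x. \<phi> (x k)) = measure_pmf.expectation (p k) \<phi>"
proof -
  have eq: "p k = map_pmf (\<lambda>x. x k) (Pi_pmf I dflt p)" using assms by (simp add: Pi_pmf_component)
  show "integrable (measure_pmf (Pi_pmf I dflt p)) (\<lambda>x. \<phi> (x k))"
    using assms(3) by (subst (asm) eq) simp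
  show "measure_pmf.expectation (Pi_pmf I dflt p) (\<lambda>x. \<phi> (x k)) = measure_pmf.expectation (p k) \<phi>"
    using arg_cong[OF eq, of "\<lambda>r. measure_pmf.expectation r \<phi>"] by simp
qed

text \<open>Adding and subtracting the sum of \<open>lam k * w k * f (S x + w k)\<close> splits the
  Stein expression into \<open>R\<close>, which the grid error bounds at every single x, and the
  terms \<open>r k\<close>, which are controlled only in mean over coordinate k. In \<open>R\<close>
  the argument \<open>S x + w k\<close> still contains the k-th summand, so independence enters only
  through \<open>r k\<close>.\<close>

lemma deterministic_weights_error:
  fixes \<theta> :: real and n :: nat and w lam t :: "nat \<Rightarrow> real" and f F :: "real \<Rightarrow> real"
    and p q :: "nat \<Rightarrow> nat pmf"
  defines "S \<equiv> \<lambda>x :: nat \<Rightarrow> nat. \<Sum>k=1..n. w k * real (x k)"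
  assumes \<theta>: "\<theta> > 0" and n: "n \<ge> 1"
    and w: "\<And>k. k \<in> {1..n} \<Longrightarrow> w k \<ge> 0"
    and t0: "t 0 = 0" and t_mono: "\<And>k. k \<in> {1..n} \<Longrightarrow> t (k - 1) \<le> t k"
    and f_bd: "\<And>x. \<bar>f x\<bar> \<le> 1" and f_lip: "(1/2)-lipschitz_on UNIV f"
    and F: "\<And>x. (F has_real_derivative f x) (at x)"
    and p: "\<And>k. k \<in> {1..n} \<Longrightarrow> integrable (measure_pmf (p k)) real"
    and sb: "\<And>k. k \<in> {1..n} \<Longrightarrow> is_size_biased (p k) (q k)"
    and lam: "\<And>k. k \<in> {1..n} \<Longrightarrow> lam k = measure_pmf.expectation (p k) real"
  shows "ennreal \<bar>measure_pmf.expectation (Pi_pmf {1..n} 0 p) (\<lambda>x. S x * f (S x) - \<theta> * (F (S x + 1) - F (S x)))\<bar>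
    \<le> eps11 \<theta> n w lam t (\<lambda>k. wasserstein1 (real_law (q k)) (real_law (map_pmf Suc (p k))))"
proof -
  let ?I = "{1..n}"
  let ?P = "Pi_pmf ?I 0 p"
  let ?d = "\<lambda>k. wasserstein1 (real_law (q k)) (real_law (map_pmf Suc (p k)))"
  define r where "r = (\<lambda>k x. w k * real (x k) * f (S x) - lam k * w k * f (S x + w k))"
  define E where "E = \<theta> * t n / 4 * grid_mesh n t + (1 + t n / 2) * grid_dev_max \<theta> n w lam t + \<theta> * \<bar>t n - 1\<bar>"
  define E' where "E' = 1/2 * (\<Sum>k=1..n. lam k * w k * \<bar>w k - t k\<bar>)"
  define b where "b = (\<lambda>k. ennreal (1/2) * (ennreal (lam k * w k) * (ennreal (w k) * ?d k)))"
  define R where "R = (\<lambda>x. (\<Sum>k=1..n. lam k * w k * f (S x + w k)) - \<theta> * (F (S x + 1) - F (S x)))"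
  have lam0: "lam k \<ge> 0" if "k \<in> ?I" for k
    unfolding lam[OF that] by (intro integral_nonneg_AE) auto
  have R_le: "\<bar>R x\<bar> \<le> E + E'" for x
    unfolding R_def E_def E'_def using grid_stein_error[OF \<theta> n w lam0 t0 t_mono f_bd f_lip F, where s = "S x"] by simp
  have iR: "integrable ?P R"
    using R_le by (intro measure_pmf.integrable_const_bound[where B="E + E'"]) auto
  have ir: "integrable ?P (r k)" if k: "k \<in> ?I" for k
  proof -
    have ix: "integrable ?P (\<lambda>x. real (x k))"
      using k p[OF k] by (intro integrable_Pi_pmf_component(1)) auto
    have "integrable ?P (\<lambda>x. w k * real (x k) * f (S x))"
    proof (rule Bochner_Integration.integrable_bound)
      show "integrable ?P (\<lambda>x. w k * real (x k))" using ix by simp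
      show "AE x in ?P. norm (w k * real (x k) * f (S x)) \<le> norm (w k * real (x k))"
        using f_bd by (auto simp: abs_mult intro!: mult_left_le)
    qed simp
    moreover have "integrable ?P (\<lambda>x. lam k * w k * f (S x + w k))"
      using f_bd by (intro integrable_mult_right measure_pmf.integrable_const_bound[where B=1]) auto
    ultimately show ?thesis unfolding r_def by simp
  qed
  have r_le: "ennreal \<bar>measure_pmf.expectation ?P (r k)\<bar> \<le> b k" if k: "k \<in> ?I" for k
  proof -
    let ?N = "Pi_pmf (?I - {k}) 0 p"
    have "ennreal \<bar>measure_pmf.expectation ?P (r k)\<bar> \<le> (\<integral>\<^sup>+ y. b k \<partial>measure_pmf ?N)"
    proof (rule abs_integral_disintegration_le[where K = "\<lambda>_. measure_pmf (p k)" and g = "\<lambda>y z. r k (y(k := z))"])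
      show "AE y in ?N. integrable (measure_pmf (p k)) (\<lambda>z. r k (y(k := z))) \<longrightarrow>
           ennreal \<bar>measure_pmf.expectation (p k) (\<lambda>z. r k (y(k := z)))\<bar> \<le> b k"
      proof (intro AE_I2 impI)
        fix y :: "nat \<Rightarrow> nat"
        define c where "c = (\<Sum>j\<in>?I - {k}. w j * real (y j))"
        have "S (y(k := z)) = c + w k * real z" for z
          unfolding S_def c_def using k by (subst sum.remove[of _ k]) auto
        hence "r k (y(k := z)) = w k * real z * f (c + w k * real z) - lam k * w k * f (c + w k * real z + w k)" for z
          by (simp add: r_def)
        thus "ennreal \<bar>measure_pmf.expectation (p k) (\<lambda>z. r k (y(k := z)))\<bar> \<le> b k"
          unfolding b_def using size_bias_error[OF f_bd f_lip p[OF k] sb[OF k] w[OF k] lam[OF k], of c] by simp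
      qed
      show "integrable ?P (r k)" by (rule ir[OF k])
      show "(\<integral>\<^sup>+ x. ennreal (r k x) \<partial>?P) = (\<integral>\<^sup>+ y. \<integral>\<^sup>+ z. ennreal (r k (y(k := z))) \<partial>p k \<partial>?N)"
        by (rule nn_integral_Pi_pmf_component[where p = p and \<phi> = "\<lambda>x. ennreal (r k x)", OF finite_atLeastAtMost k])
      show "(\<integral>\<^sup>+ x. ennreal (- r k x) \<partial>?P) = (\<integral>\<^sup>+ y. \<integral>\<^sup>+ z. ennreal (- r k (y(k := z))) \<partial>p k \<partial>?N)"
        by (rule nn_integral_Pi_pmf_component[where p = p and \<phi> = "\<lambda>x. ennreal (- r k x)", OF finite_atLeastAtMost k])
    qed simp_all
    also have "\<dots> = b k"
      by (simp only: nn_integral_const measure_pmf.emeasure_space_1 mult_1_right)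
    finally show ?thesis .
  qed
  have "S x * f (S x) - \<theta> * (F (S x + 1) - F (S x)) = R x + (\<Sum>k=1..n. r k x)" for x
    unfolding R_def r_def by (simp add: sum_subtractf S_def sum_distrib_right)
  hence "measure_pmf.expectation ?P (\<lambda>x. S x * f (S x) - \<theta> * (F (S x + 1) - F (S x))) =
    measure_pmf.expectation ?P (\<lambda>x. R x + (\<Sum>k=1..n. r k x))"
    by presburger
  also have "\<dots> = measure_pmf.expectation ?P R + (\<Sum>k=1..n. measure_pmf.expectation ?P (r k))"
    using iR ir by (subst Bochner_Integration.integral_add) (auto intro!: Bochner_Integration.integral_sum)
  also have "ennreal \<bar>\<dots>\<bar> \<le> ennreal \<bar>measure_pmf.expectation ?P R\<bar> + (\<Sum>k=1..n. ennreal \<bar>measure_pmf.expectation ?P (r k)\<bar>)"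
    (is "ennreal \<bar>?A + sum ?B _\<bar> \<le> _")
  proof -
    have "ennreal \<bar>?A + sum ?B ?I\<bar> \<le> ennreal (\<bar>?A\<bar> + (\<Sum>k=1..n. \<bar>?B k\<bar>))"
      by (intro ennreal_leI order_trans[OF abs_triangle_ineq] add_left_mono sum_abs)
    thus ?thesis by (simp add: sum_nonneg)
  qed
  also have "\<dots> \<le> ennreal (E + E') + (\<Sum>k=1..n. b k)"
  proof (intro add_mono sum_mono r_le ennreal_leI)
    have "\<bar>measure_pmf.expectation ?P R\<bar> \<le> measure_pmf.expectation ?P (\<lambda>x. \<bar>R x\<bar>)" by simp
    also have "\<dots> \<le> measure_pmf.expectation ?P (\<lambda>x. E + E')"
      using R_le iR by (intro integral_mono) auto
    finally show "\<bar>measure_pmf.expectation ?P R\<bar> \<le> E + E'" by simp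
  qed auto
  also have "ennreal (E + E') = ennreal E + ennreal E'"
  proof (rule ennreal_plus)
    show "0 \<le> E'" unfolding E'_def using w lam0 by (intro mult_nonneg_nonneg sum_nonneg) auto
    show "0 \<le> E" unfolding E_def
      using grid_mesh_nonneg[of n t, OF n t_mono] grid_dev_max_nonneg[OF n, of \<theta> w lam t]
        grid_nonneg[of t n n, OF t0 t_mono order_refl] \<theta> by simp
  qed
  also have "ennreal E' = ennreal (1/2) * (\<Sum>k=1..n. ennreal (lam k * w k) * ennreal \<bar>w k - t k\<bar>)"
  proof -
    have "(\<Sum>k=1..n. ennreal (lam k * w k) * ennreal \<bar>w k - t k\<bar>) = ennreal (\<Sum>k=1..n. lam k * w k * \<bar>w k - t k\<bar>)"
      using w lam0 by (subst sum_ennreal[symmetric]) (auto intro!: sum.cong simp flip: ennreal_mult)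
    thus ?thesis unfolding E'_def using w lam0
      by (subst ennreal_mult) (auto intro!: sum_nonneg)
  qed
  also have "ennreal E + ennreal (1/2) * (\<Sum>k=1..n. ennreal (lam k * w k) * ennreal \<bar>w k - t k\<bar>) + (\<Sum>k=1..n. b k) =
    eps11 \<theta> n w lam t ?d"
    unfolding eps11_def E_def b_def by (simp add: sum_distrib_left distrib_left sum.distrib add_ac)
  finally show ?thesis .
qed

section \<open>Conditioning on the weights\<close>

lemma measurable_pair_measure_countable2:
  assumes "countable C" "\<And>x. x \<in> C \<Longrightarrow> (\<lambda>y. f (y, x)) \<in> measurable N L"
  shows "f \<in> measurable (N \<Otimes>\<^sub>M count_space C) L"
proof -
  have "(\<lambda>z. (\<lambda>x z. f (fst z, x)) (snd z) z) \<in> measurable (N \<Otimes>\<^sub>M count_space C) L"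
  proof (rule measurable_compose_countable'[OF _ measurable_snd assms(1)])
    show "(\<lambda>z. f (fst z, x)) \<in> measurable (N \<Otimes>\<^sub>M count_space C) L" if "x \<in> C" for x
      by (rule measurable_compose[OF measurable_fst assms(2)[OF that]])
  qed
  thus ?thesis by simp
qed

context finite_measure_subalgebra
begin

text \<open>\<open>real_cond_exp\<close> is a difference of two nonnegative conditional expectations
  passed through \<open>enn2real\<close>. For an indicator the subtracted one vanishes and the other
  is at most 1, so nothing is lost and u may take infinite values.\<close>

lemma nn_integral_indicator_cond_prob_sub:
  assumes [measurable]: "u \<in> borel_measurable F" and A: "{\<omega> \<in> space M. P \<omega>} \<in> sets M"
  shows "(\<integral>\<^sup>+ \<omega>. u \<omega> * indicator {\<omega> \<in> space M. P \<omega>} \<omega> \<partial>M) = (\<integral>\<^sup>+ \<omega>. u \<omega> * ennreal (cond_prob_sub M F P \<omega>) \<partial>M)"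
proof -
  let ?A = "{\<omega> \<in> space M. P \<omega>}"
  have A'[measurable]: "?A \<in> sets M" by fact
  have "(\<integral>\<^sup>+ \<omega>. u \<omega> * indicator ?A \<omega> \<partial>M) = (\<integral>\<^sup>+ \<omega>. u \<omega> * ennreal (indicator ?A \<omega>) \<partial>M)"
    by (simp add: ennreal_indicator)
  also have "\<dots> = (\<integral>\<^sup>+ \<omega>. u \<omega> * nn_cond_exp M F (\<lambda>\<omega>. ennreal (indicator ?A \<omega>)) \<omega> \<partial>M)"
    by (subst nn_cond_exp_intg) simp_all
  also have "\<dots> = (\<integral>\<^sup>+ \<omega>. u \<omega> * ennreal (cond_prob_sub M F P \<omega>) \<partial>M)"
  proof (rule nn_integral_cong_AE)
    have "AE \<omega> in M. nn_cond_exp M F (\<lambda>\<omega>. ennreal (indicator ?A \<omega>)) \<omega> \<le> nn_cond_exp M F (\<lambda>\<omega>. 1) \<omega>"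
      by (intro nn_cond_exp_mono) (auto simp: indicator_def)
    moreover have "AE \<omega> in M. 1 = nn_cond_exp M F (\<lambda>\<omega>. 1) \<omega>"
      by (rule nn_cond_exp_F_meas) simp
    moreover have "AE \<omega> in M. 0 = nn_cond_exp M F (\<lambda>\<omega>. 0) \<omega>"
      by (rule nn_cond_exp_F_meas) simp
    ultimately show "AE \<omega> in M. u \<omega> * nn_cond_exp M F (\<lambda>\<omega>. ennreal (indicator ?A \<omega>)) \<omega> = u \<omega> * ennreal (cond_prob_sub M F P \<omega>)"
    proof eventually_elim
      case (elim \<omega>)
      have "(\<lambda>\<omega>. ennreal (- (indicator ?A \<omega> :: real))) = (\<lambda>_. 0)"
        by (auto simp: indicator_def fun_eq_iff ennreal_neg)
      hence "cond_prob_sub M F P \<omega> = enn2real (nn_cond_exp M F (\<lambda>\<omega>. ennreal (indicator ?A \<omega>)) \<omega>)"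
        unfolding cond_prob_sub_def real_cond_exp_def using elim(3) by simp
      moreover have "nn_cond_exp M F (\<lambda>\<omega>. ennreal (indicator ?A \<omega>)) \<omega> < top"
        using elim by (metis ennreal_one_less_top le_less_trans)
      ultimately show ?case by simp
    qed
  qed
  finally show ?thesis .
qed

text \<open>Splitting over the values x of Y reduces the claim, by Tonelli over a countable set, to
  integrals over the events Y = x. There \<psi> with x fixed is measurable for \<open>F\<close>, so
  the indicator may be exchanged for its conditional probability. The carrier \<open>C\<close>
  admits an uncountable type of values, such as functions on indices, of which only countably many
  occur.\<close>

lemma disintegration_countable:
  fixes Y :: "'a \<Rightarrow> 'c" and K :: "'a \<Rightarrow> 'c pmf"
  assumes C: "countable C" and Y: "Y \<in> measurable M (count_space UNIV)" "\<And>\<omega>. \<omega> \<in> space M \<Longrightarrow> Y \<omega> \<in> C"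
    and K_meas [measurable]: "\<And>x. x \<in> C \<Longrightarrow> (\<lambda>\<omega>. pmf (K \<omega>) x) \<in> borel_measurable F"
    and K_set: "\<And>\<omega>. set_pmf (K \<omega>) \<subseteq> C"
    and K: "\<And>x. x \<in> C \<Longrightarrow> AE \<omega> in M. pmf (K \<omega>) x = cond_prob_sub M F (\<lambda>\<omega>'. Y \<omega>' = x) \<omega>"
    and \<psi> [measurable]: "\<And>x. x \<in> C \<Longrightarrow> (\<lambda>\<omega>. \<psi> \<omega> x) \<in> borel_measurable F"
  shows "(\<lambda>\<omega>. \<integral>\<^sup>+ x. \<psi> \<omega> x \<partial>measure_pmf (K \<omega>)) \<in> borel_measurable F"
    and "(\<integral>\<^sup>+ \<omega>. \<psi> \<omega> (Y \<omega>) \<partial>M) = (\<integral>\<^sup>+ \<omega>. \<integral>\<^sup>+ x. \<psi> \<omega> x \<partial>measure_pmf (K \<omega>) \<partial>M)"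
proof -
  interpret C: sigma_finite_measure "count_space C"
    by (rule sigma_finite_measure_count_space_countable[OF C])
  interpret MC: pair_sigma_finite M "count_space C" ..
  have Ksum: "(\<integral>\<^sup>+ x. \<psi> \<omega> x \<partial>measure_pmf (K \<omega>)) = (\<integral>\<^sup>+ x. ennreal (pmf (K \<omega>) x) * \<psi> \<omega> x \<partial>count_space C)" for \<omega>
    unfolding nn_integral_measure_pmf
    by (rule nn_integral_count_space_eq) (use K_set[of \<omega>] in \<open>auto simp: set_pmf_iff\<close>)
  have [measurable]: "(\<lambda>z. ennreal (pmf (K (fst z)) (snd z)) * \<psi> (fst z) (snd z)) \<in> borel_measurable (F \<Otimes>\<^sub>M count_space C)"
    by (rule measurable_pair_measure_countable2[OF C]) simp
  show 1: "(\<lambda>\<omega>. \<integral>\<^sup>+ x. \<psi> \<omega> x \<partial>measure_pmf (K \<omega>)) \<in> borel_measurable F"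
    unfolding Ksum by (rule C.borel_measurable_nn_integral) (simp add: case_prod_unfold)
  have FM: "u \<in> borel_measurable M" if "u \<in> borel_measurable F" for u :: "'a \<Rightarrow> ennreal"
    by (rule measurable_from_subalg[OF subalg that])
  have A: "{\<omega> \<in> space M. Y \<omega> = x} \<in> sets M" for x
    using measurable_sets[OF Y(1), of "{x}"] by (simp add: vimage_def Int_def conj_commute)
  have "(\<integral>\<^sup>+ \<omega>. \<psi> \<omega> (Y \<omega>) \<partial>M) = (\<integral>\<^sup>+ \<omega>. \<integral>\<^sup>+ x. \<psi> \<omega> x * indicator {\<omega> \<in> space M. Y \<omega> = x} \<omega> \<partial>count_space C \<partial>M)"
  proof (rule nn_integral_cong)
    fix \<omega> assume \<omega>: "\<omega> \<in> space M"
    have "(\<integral>\<^sup>+ x. \<psi> \<omega> x * indicator {\<omega> \<in> space M. Y \<omega> = x} \<omega> \<partial>count_space C) =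
      (\<integral>\<^sup>+ x. \<psi> \<omega> x * indicator {Y \<omega>} x \<partial>count_space C)"
      by (rule nn_integral_cong) (use \<omega> in \<open>auto simp: indicator_def\<close>)
    also have "\<dots> = \<psi> \<omega> (Y \<omega>)"
      using Y(2)[OF \<omega>] by (subst nn_integral_indicator_singleton) (auto simp: emeasure_count_space)
    finally show "\<psi> \<omega> (Y \<omega>) = (\<integral>\<^sup>+ x. \<psi> \<omega> x * indicator {\<omega> \<in> space M. Y \<omega> = x} \<omega> \<partial>count_space C)" by simp
  qed
  also have "\<dots> = (\<integral>\<^sup>+ x. \<integral>\<^sup>+ \<omega>. \<psi> \<omega> x * indicator {\<omega> \<in> space M. Y \<omega> = x} \<omega> \<partial>M \<partial>count_space C)"
  proof (rule MC.Fubini'[symmetric])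
    show "(\<lambda>(\<omega>, x). \<psi> \<omega> x * indicator {\<omega> \<in> space M. Y \<omega> = x} \<omega>) \<in> borel_measurable (M \<Otimes>\<^sub>M count_space C)"
      by (rule measurable_pair_measure_countable2[OF C]) (use A FM[OF \<psi>] in auto)
  qed
  also have "\<dots> = (\<integral>\<^sup>+ x. \<integral>\<^sup>+ \<omega>. ennreal (pmf (K \<omega>) x) * \<psi> \<omega> x \<partial>M \<partial>count_space C)"
  proof (rule nn_integral_cong)
    fix x assume "x \<in> space (count_space C)"
    hence x: "x \<in> C" by simp
    have "(\<integral>\<^sup>+ \<omega>. \<psi> \<omega> x * indicator {\<omega> \<in> space M. Y \<omega> = x} \<omega> \<partial>M) =
       (\<integral>\<^sup>+ \<omega>. \<psi> \<omega> x * ennreal (cond_prob_sub M F (\<lambda>\<omega>. Y \<omega> = x) \<omega>) \<partial>M)"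
      by (rule nn_integral_indicator_cond_prob_sub[OF \<psi>[OF x] A])
    also have "\<dots> = (\<integral>\<^sup>+ \<omega>. ennreal (pmf (K \<omega>) x) * \<psi> \<omega> x \<partial>M)"
      by (rule nn_integral_cong_AE) (use K[OF x] in \<open>eventually_elim, simp add: mult.commute\<close>)
    finally show "(\<integral>\<^sup>+ \<omega>. \<psi> \<omega> x * indicator {\<omega> \<in> space M. Y \<omega> = x} \<omega> \<partial>M) =
      (\<integral>\<^sup>+ \<omega>. ennreal (pmf (K \<omega>) x) * \<psi> \<omega> x \<partial>M)" .
  qed
  also have "\<dots> = (\<integral>\<^sup>+ \<omega>. \<integral>\<^sup>+ x. ennreal (pmf (K \<omega>) x) * \<psi> \<omega> x \<partial>count_space C \<partial>M)"
  proof (rule MC.Fubini')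
    show "(\<lambda>(\<omega>, x). ennreal (pmf (K \<omega>) x) * \<psi> \<omega> x) \<in> borel_measurable (M \<Otimes>\<^sub>M count_space C)"
      by (rule measurable_pair_measure_countable2[OF C]) (simp add: FM)
  qed
  finally show "(\<integral>\<^sup>+ \<omega>. \<psi> \<omega> (Y \<omega>) \<partial>M) = (\<integral>\<^sup>+ \<omega>. \<integral>\<^sup>+ x. \<psi> \<omega> x \<partial>measure_pmf (K \<omega>) \<partial>M)"
    by (simp add: Ksum)
qed

lemma nn_cond_exp_eq_cond_law:
  fixes Y :: "'a \<Rightarrow> nat"
  assumes Y: "Y \<in> measurable M (count_space UNIV)" and K: "is_cond_law M F Y K"
  shows "AE \<omega> in M. (\<integral>\<^sup>+ x. ennreal (real x) \<partial>measure_pmf (K \<omega>)) = nn_cond_exp M F (\<lambda>\<omega>. ennreal (real (Y \<omega>))) \<omega>"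
proof (rule nn_cond_exp_charact)
  have pmf: "(\<lambda>\<omega>. pmf (K \<omega>) x) \<in> borel_measurable F"
    "AE \<omega> in M. pmf (K \<omega>) x = cond_prob_sub M F (\<lambda>\<omega>'. Y \<omega>' = x) \<omega>" for x
    using K[unfolded is_cond_law_def, rule_format, of "{x}"] by (simp_all add: measure_pmf_single)
  note dis = disintegration_countable[where C = UNIV and Y = Y and K = K, OF _ Y _ pmf(1) _ pmf(2)]
  show "(\<lambda>\<omega>. \<integral>\<^sup>+ x. ennreal (real x) \<partial>measure_pmf (K \<omega>)) \<in> borel_measurable F"
    by (rule dis(1)) auto
  show "(\<lambda>\<omega>. ennreal (real (Y \<omega>))) \<in> borel_measurable M"
    using Y by measurable
  fix A assume [measurable]: "A \<in> sets F"
  have "(\<integral>\<^sup>+ \<omega>. ennreal (real (Y \<omega>)) * indicator A \<omega> \<partial>M) = (\<integral>\<^sup>+ \<omega>. \<integral>\<^sup>+ x. ennreal (real x) * indicator A \<omega> \<partial>measure_pmf (K \<omega>) \<partial>M)"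
    by (rule dis(2)) auto
  also have "\<dots> = (\<integral>\<^sup>+ \<omega>. (\<integral>\<^sup>+ x. ennreal (real x) \<partial>measure_pmf (K \<omega>)) * indicator A \<omega> \<partial>M)"
    by (simp add: nn_integral_multc)
  finally show "(\<integral>\<^sup>+ \<omega>\<in>A. ennreal (real (Y \<omega>)) \<partial>M) = (\<integral>\<^sup>+ \<omega>\<in>A. (\<integral>\<^sup>+ x. ennreal (real x) \<partial>measure_pmf (K \<omega>)) \<partial>M)" .
qed

text \<open>\<open>real_cond_exp\<close> is total and would send an infinite conditional mean to 0.
  Finiteness rules this out, so the real-valued conditional expectation is the genuine mean of the
  conditional law.\<close>

lemma cond_mean_eq_cond_law:
  fixes Y :: "'a \<Rightarrow> nat"
  assumes Y: "Y \<in> measurable M (count_space UNIV)" and K: "is_cond_law M F Y K"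
    and fin: "AE \<omega> in M. nn_cond_exp M F (\<lambda>\<omega>. ennreal (real (Y \<omega>))) \<omega> < \<infinity>"
  shows "AE \<omega> in M. integrable (measure_pmf (K \<omega>)) real \<and>
    real_cond_exp M F (\<lambda>\<omega>. real (Y \<omega>)) \<omega> = measure_pmf.expectation (K \<omega>) real"
proof -
  have "AE \<omega> in M. 0 = nn_cond_exp M F (\<lambda>\<omega>. 0) \<omega>"
    by (rule nn_cond_exp_F_meas) simp
  with fin nn_cond_exp_eq_cond_law[OF Y K] show ?thesis
  proof eventually_elim
    case (elim \<omega>)
    hence int: "integrable (measure_pmf (K \<omega>)) real"
      by (intro integrableI_bounded) auto
    have "real_cond_exp M F (\<lambda>\<omega>. real (Y \<omega>)) \<omega> = enn2real (nn_cond_exp M F (\<lambda>\<omega>. ennreal (real (Y \<omega>))) \<omega>)"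
      unfolding real_cond_exp_def using elim(3) by (simp add: ennreal_neg)
    also have "\<dots> = enn2real (\<integral>\<^sup>+ x. ennreal (real x) \<partial>measure_pmf (K \<omega>))" using elim(2) by simp
    also have "\<dots> = measure_pmf.expectation (K \<omega>) real" by (subst integral_eq_nn_integral) auto
    finally show ?case using int by simp
  qed
qed

text \<open>Conditional probabilities are fixed only up to a null set for each event, but on a
  countable range the singletons suffice: there the product formula of conditional independence is
  the point mass of \<open>Pi_pmf\<close>.\<close>

lemma disintegration_cond_indep:
  fixes X :: "nat \<Rightarrow> 'a \<Rightarrow> nat" and I :: "nat set"
  assumes I: "finite I" and X: "\<And>k. k \<in> I \<Longrightarrow> X k \<in> measurable M (count_space UNIV)"
    and indep: "cond_indep_nat_vars M F X J" and IJ: "I \<subseteq> J"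
    and K: "\<And>k. k \<in> I \<Longrightarrow> is_cond_law M F (X k) (K k)"
    and \<psi>: "\<And>x. (\<lambda>\<omega>. \<psi> \<omega> x) \<in> borel_measurable F"
  shows "(\<lambda>\<omega>. \<integral>\<^sup>+ x. \<psi> \<omega> x \<partial>measure_pmf (Pi_pmf I 0 (\<lambda>k. K k \<omega>))) \<in> borel_measurable F"
    and "(\<integral>\<^sup>+ \<omega>. \<psi> \<omega> (\<lambda>k. if k \<in> I then X k \<omega> else 0) \<partial>M) =
      (\<integral>\<^sup>+ \<omega>. \<integral>\<^sup>+ x. \<psi> \<omega> x \<partial>measure_pmf (Pi_pmf I 0 (\<lambda>k. K k \<omega>)) \<partial>M)"
proof -
  \<comment> \<open>The value 0 off \<open>I\<close> agrees with the default value of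
    \<open>Pi_pmf\<close>. It leaves countably many functions, which makes \<open>Y\<close>
    measurable for the full power set of its type.\<close>
  define C where "C = PiE_dflt I (0::nat) (\<lambda>_. UNIV :: nat set)"
  define Y where "Y = (\<lambda>\<omega> k. if k \<in> I then X k \<omega> else 0)"
  have C: "countable C"
    unfolding C_def dflt_image_PiE[symmetric] using I by (intro countable_image countable_PiE) auto
  have Y_in: "Y \<omega> \<in> C" for \<omega> by (simp add: Y_def C_def PiE_dflt_def)
  have A: "{\<omega> \<in> space M. Y \<omega> = x} = {\<omega> \<in> space M. \<forall>k\<in>I. X k \<omega> \<in> {x k}}" if "x \<in> C" for x
    using that by (auto simp: Y_def C_def PiE_dflt_def fun_eq_iff split: if_splits)
  have A_meas: "{\<omega> \<in> space M. \<forall>k\<in>I. X k \<omega> \<in> {x k}} \<in> sets M" for x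
  proof (rule sets.sets_Collect_finite_All[OF _ I])
    show "{\<omega> \<in> space M. X k \<omega> \<in> {x k}} \<in> sets M" if "k \<in> I" for k
      using measurable_sets[OF X[OF that], of "{x k}"] by (simp add: vimage_def Int_def conj_commute)
  qed
  have Y_meas: "Y \<in> measurable M (count_space UNIV)"
  proof (rule measurable_compose[of Y M "count_space C" "\<lambda>x. x"])
    show "Y \<in> measurable M (count_space C)"
    proof (subst measurable_count_space_eq_countable[OF C], intro conjI ballI)
      show "Y \<in> space M \<rightarrow> C" using Y_in by auto
      fix x assume "x \<in> C"
      have "Y -` {x} \<inter> space M = {\<omega> \<in> space M. Y \<omega> = x}" by auto
      thus "Y -` {x} \<inter> space M \<in> sets M" using A[OF \<open>x \<in> C\<close>] A_meas by simp
    qed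
  qed simp
  have K_pmf: "(\<lambda>\<omega>. pmf (K k \<omega>) y) \<in> borel_measurable F"
    "AE \<omega> in M. pmf (K k \<omega>) y = cond_prob_sub M F (\<lambda>\<omega>'. X k \<omega>' \<in> {y}) \<omega>" if "k \<in> I" for k y
    using K[OF that, unfolded is_cond_law_def, rule_format, of "{y}"] by (simp_all add: measure_pmf_single)
  have Pi: "pmf (Pi_pmf I 0 (\<lambda>k. K k \<omega>)) x = (\<Prod>k\<in>I. pmf (K k \<omega>) (x k))" if "x \<in> C" for x \<omega>
    using that I by (intro pmf_Pi') (auto simp: C_def PiE_dflt_def)
  have Pi_meas: "(\<lambda>\<omega>. pmf (Pi_pmf I 0 (\<lambda>k. K k \<omega>)) x) \<in> borel_measurable F" if "x \<in> C" for x
    unfolding Pi[OF that] using K_pmf(1) by (intro borel_measurable_prod) auto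
  have Pi_set: "set_pmf (Pi_pmf I 0 (\<lambda>k. K k \<omega>)) \<subseteq> C" for \<omega>
    using set_Pi_pmf_subset'[OF I] by (force simp: C_def PiE_dflt_def)
  have Pi_AE: "AE \<omega> in M. pmf (Pi_pmf I 0 (\<lambda>k. K k \<omega>)) x = cond_prob_sub M F (\<lambda>\<omega>'. Y \<omega>' = x) \<omega>" if x: "x \<in> C" for x
  proof -
    have "AE \<omega> in M. cond_prob_sub M F (\<lambda>\<omega>'. \<forall>k\<in>I. X k \<omega>' \<in> {x k}) \<omega> =
           (\<Prod>k\<in>I. cond_prob_sub M F (\<lambda>\<omega>'. X k \<omega>' \<in> {x k}) \<omega>)"
      using indep[unfolded cond_indep_nat_vars_def, rule_format, OF I IJ, of "\<lambda>k. {x k}"] .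
    moreover have "AE \<omega> in M. \<forall>k\<in>I. pmf (K k \<omega>) (x k) = cond_prob_sub M F (\<lambda>\<omega>'. X k \<omega>' \<in> {x k}) \<omega>"
      using K_pmf(2) by (intro AE_finite_allI[OF I]) auto
    ultimately show ?thesis
    proof eventually_elim
      case (elim \<omega>)
      have "cond_prob_sub M F (\<lambda>\<omega>'. Y \<omega>' = x) = cond_prob_sub M F (\<lambda>\<omega>'. \<forall>k\<in>I. X k \<omega>' \<in> {x k})"
        unfolding cond_prob_sub_def A[OF x] ..
      thus ?case unfolding Pi[OF x] using elim by simp
    qed
  qed
  note dis = disintegration_countable[where \<psi> = \<psi>, OF C Y_meas Y_in Pi_meas Pi_set Pi_AE \<psi>]
  show "(\<lambda>\<omega>. \<integral>\<^sup>+ x. \<psi> \<omega> x \<partial>measure_pmf (Pi_pmf I 0 (\<lambda>k. K k \<omega>))) \<in> borel_measurable F"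
    by (rule dis(1))
  show "(\<integral>\<^sup>+ \<omega>. \<psi> \<omega> (\<lambda>k. if k \<in> I then X k \<omega> else 0) \<partial>M) =
      (\<integral>\<^sup>+ \<omega>. \<integral>\<^sup>+ x. \<psi> \<omega> x \<partial>measure_pmf (Pi_pmf I 0 (\<lambda>k. K k \<omega>)) \<partial>M)"
    using dis(2) unfolding Y_def .
qed

end

section \<open>From conditional bounds to the unconditional distance\<close>

lemma subalgebra_array_sigma:
  assumes "\<And>m k. 1 \<le> k \<Longrightarrow> k \<le> m \<Longrightarrow> W m k \<in> borel_measurable M"
  shows "subalgebra M (array_sigma M W)"
proof -
  let ?G = "{W m k -` B \<inter> space M | m k B. 1 \<le> k \<and> k \<le> m \<and> B \<in> sets borel}"
  have "?G \<subseteq> sets M" using assms by (auto intro: measurable_sets)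
  hence "sigma_sets (space M) ?G \<subseteq> sets M" by (rule sets.sigma_sets_subset)
  moreover have "?G \<subseteq> Pow (space M)" by auto
  ultimately show ?thesis
    unfolding subalgebra_def array_sigma_def by (simp add: sets_measure_of space_measure_of)
qed

lemma array_sigma_measurable:
  assumes "1 \<le> k" "k \<le> m"
  shows "W m k \<in> borel_measurable (array_sigma M W)"
proof (rule measurableI)
  let ?G = "{W m k -` B \<inter> space M | m k B. 1 \<le> k \<and> k \<le> m \<and> B \<in> sets borel}"
  have G: "?G \<subseteq> Pow (space M)" by auto
  fix B :: "real set" assume "B \<in> sets borel"
  hence "W m k -` B \<inter> space M \<in> ?G" using assms by blast
  thus "W m k -` B \<inter> space (array_sigma M W) \<in> sets (array_sigma M W)"
    unfolding array_sigma_def using G by (simp add: sets_measure_of space_measure_of)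
qed simp

text \<open>The sum is to become the conditional mean of S. It equals the last deviation plus
  \<theta> t_n, and t_n \<le> 1 + |t_n - 1|, so the part of the error that does not involve
  \<open>d\<close> already controls it. This is how a finite bound makes S integrable.\<close>

lemma grid_mean_le_eps11:
  assumes \<theta>: "\<theta> > 0" and n: "n \<ge> 1"
    and t0: "t 0 = 0" and t_mono: "\<And>k. k \<in> {1..n} \<Longrightarrow> t (k - 1) \<le> t k"
  shows "ennreal (\<Sum>k=1..n. lam k * w k) \<le> ennreal \<theta> + eps11 \<theta> n w lam t d"
proof -
  note nonneg = grid_nonneg[of t n n, OF t0 t_mono order_refl] grid_mesh_nonneg[of n t, OF n t_mono]
    grid_dev_max_nonneg[OF n, of \<theta> w lam t]
  define E where "E = \<theta> * t n / 4 * grid_mesh n t + (1 + t n / 2) * grid_dev_max \<theta> n w lam t + \<theta> * \<bar>t n - 1\<bar>"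
  have tel: "(\<Sum>j=1..n. t j - t (j - 1)) = t n"
    using t0 by (induction n) auto
  have "(\<Sum>k=1..n. lam k * w k) = grid_dev \<theta> w lam t n + \<theta> * t n"
    unfolding grid_dev_def sum_subtractf[of "\<lambda>j. lam j * w j"] sum_distrib_left[symmetric] tel by simp
  also have "\<dots> \<le> 1 * grid_dev_max \<theta> n w lam t + \<theta> * (1 + \<bar>t n - 1\<bar>)"
    using grid_dev_max_ge[of n n \<theta> w lam t] n \<theta> by (intro add_mono mult_left_mono) auto
  also have "\<dots> \<le> (1 + t n / 2) * grid_dev_max \<theta> n w lam t + \<theta> * (1 + \<bar>t n - 1\<bar>)"
    using nonneg by (intro add_mono mult_right_mono) auto
  also have "\<dots> \<le> \<theta> + (\<theta> * t n / 4 * grid_mesh n t + (1 + t n / 2) * grid_dev_max \<theta> n w lam t + \<theta> * \<bar>t n - 1\<bar>)"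
    using nonneg \<theta> by (simp add: distrib_left)
  finally have "ennreal (\<Sum>k=1..n. lam k * w k) \<le> ennreal (\<theta> + E)"
    unfolding E_def by (rule ennreal_leI)
  also have "\<dots> = ennreal \<theta> + ennreal E"
    using nonneg \<theta> by (intro ennreal_plus) (auto simp: E_def)
  also have "\<dots> \<le> ennreal \<theta> + eps11 \<theta> n w lam t d"
    unfolding eps11_def E_def by (intro add_left_mono) simp
  finally show ?thesis .
qed

theorem theorem1p4:
  fixes M :: "'a measure"
    and W :: "nat \<Rightarrow> nat \<Rightarrow> 'a \<Rightarrow> real"
    and X :: "nat \<Rightarrow> 'a \<Rightarrow> nat"
    and t :: "nat \<Rightarrow> 'a \<Rightarrow> real"
    and \<kappa> \<kappa>s :: "nat \<Rightarrow> 'a \<Rightarrow> nat pmf"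
    and lam :: "nat \<Rightarrow> 'a \<Rightarrow> real"
    and D :: "real measure"
    and \<theta> :: real and n :: nat
  assumes "prob_space M" and "\<theta> > 0" and "n \<ge> 1"
    and "\<And>m k. 1 \<le> k \<Longrightarrow> k \<le> m \<Longrightarrow> W m k \<in> borel_measurable M"
    and "\<And>m k. 1 \<le> k \<Longrightarrow> k \<le> m \<Longrightarrow> AE \<omega> in M. 0 \<le> W m k \<omega>"
    and "\<And>k. 1 \<le> k \<Longrightarrow> X k \<in> measurable M (count_space UNIV)"
    and "cond_indep_nat_vars M (array_sigma M W) X {1..}"
    and "\<And>k. 1 \<le> k \<Longrightarrow>
           AE \<omega> in M. nn_cond_exp M (array_sigma M W) (\<lambda>\<omega>'. ennreal (real (X k \<omega>'))) \<omega> < \<infinity>"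
    and "\<And>k. lam k = real_cond_exp M (array_sigma M W) (\<lambda>\<omega>'. real (X k \<omega>'))"
    and "\<And>k. k \<le> n \<Longrightarrow> t k \<in> borel_measurable (array_sigma M W)"
    and "AE \<omega> in M. t 0 \<omega> = 0"
    and "\<And>k. 1 \<le> k \<Longrightarrow> k \<le> n \<Longrightarrow> AE \<omega> in M. t (k - 1) \<omega> \<le> t k \<omega>"
    and "\<And>k. 1 \<le> k \<Longrightarrow> k \<le> n \<Longrightarrow> is_cond_law M (array_sigma M W) (X k) (\<kappa> k)"
    and "\<And>k. 1 \<le> k \<Longrightarrow> k \<le> n \<Longrightarrow> AE \<omega> in M. is_size_biased (\<kappa> k \<omega>) (\<kappa>s k \<omega>)"
    and "is_dickman \<theta> D"
  shows "d11 (distr M borel (\<lambda>\<omega>. \<Sum>k=1..n. W n k \<omega> * real (X k \<omega>))) D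
    \<le> (\<integral>\<^sup>+ \<omega>. eps11 \<theta> n (\<lambda>k. W n k \<omega>) (\<lambda>k. lam k \<omega>) (\<lambda>k. t k \<omega>)
          (\<lambda>k. wasserstein1 (real_law (\<kappa>s k \<omega>)) (real_law (map_pmf Suc (\<kappa> k \<omega>)))) \<partial>M)"
proof -
  define G where "G = array_sigma M W"
  define I where "I = {1..n}"
  define S where "S = (\<lambda>\<omega>. \<Sum>k=1..n. W n k \<omega> * real (X k \<omega>))"
  define P where "P = (\<lambda>\<omega>. Pi_pmf I 0 (\<lambda>k. \<kappa> k \<omega>))"
  define \<epsilon> where "\<epsilon> = (\<lambda>\<omega>. eps11 \<theta> n (\<lambda>k. W n k \<omega>) (\<lambda>k. lam k \<omega>) (\<lambda>k. t k \<omega>)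
          (\<lambda>k. wasserstein1 (real_law (\<kappa>s k \<omega>)) (real_law (map_pmf Suc (\<kappa> k \<omega>)))))"
  interpret prob_space M by fact
  have sub: "subalgebra M G" unfolding G_def by (rule subalgebra_array_sigma[OF assms(4)])
  interpret G: finite_measure_subalgebra M G by unfold_locales (rule sub)
  have W_G [measurable]: "W n k \<in> borel_measurable G" if "k \<in> I" for k
    unfolding G_def by (rule array_sigma_measurable) (use that in \<open>auto simp: I_def\<close>)
  have W_M: "W n k \<in> borel_measurable M" if "k \<in> I" for k
    using assms(4) that by (auto simp: I_def)
  have X_M: "X k \<in> measurable M (count_space UNIV)" if "k \<in> I" for k
    using assms(6) that by (auto simp: I_def)
  have law: "is_cond_law M G (X k) (\<kappa> k)" if "k \<in> I" for k
    using assms(13) that by (auto simp: I_def G_def)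
  have S_M: "S \<in> borel_measurable M"
    unfolding S_def using W_M measurable_compose[OF X_M, of _ real]
    by (intro borel_measurable_sum borel_measurable_times) (auto simp: I_def)
  \<comment> \<open>One null set collects all almost sure hypotheses, so that the results for
    deterministic weights apply to every remaining outcome.\<close>
  have ae: "AE \<omega> in M. (\<forall>k\<in>I. 0 \<le> W n k \<omega> \<and> t (k - 1) \<omega> \<le> t k \<omega> \<and> is_size_biased (\<kappa> k \<omega>) (\<kappa>s k \<omega>) \<and>
      integrable (measure_pmf (\<kappa> k \<omega>)) real \<and> lam k \<omega> = measure_pmf.expectation (\<kappa> k \<omega>) real) \<and> t 0 \<omega> = 0"
  proof (rule AE_conjI[OF AE_finite_allI assms(11)])
    show "AE \<omega> in M. 0 \<le> W n k \<omega> \<and> t (k - 1) \<omega> \<le> t k \<omega> \<and> is_size_biased (\<kappa> k \<omega>) (\<kappa>s k \<omega>) \<and>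
      integrable (measure_pmf (\<kappa> k \<omega>)) real \<and> lam k \<omega> = measure_pmf.expectation (\<kappa> k \<omega>) real" if k: "k \<in> I" for k
    proof -
      have k': "1 \<le> k" "k \<le> n" using k by (auto simp: I_def)
      show ?thesis
        using assms(5)[OF k'] assms(12)[OF k'] assms(14)[OF k']
          G.cond_mean_eq_cond_law[OF X_M[OF k] law[OF k] assms(8)[OF k'(1), folded G_def]]
        unfolding assms(9) G_def[symmetric] by eventually_elim auto
    qed
  qed (simp add: I_def)
  have S_nonneg: "AE \<omega> in M. 0 \<le> S \<omega>"
    using ae by eventually_elim (auto simp: S_def I_def intro!: sum_nonneg mult_nonneg_nonneg)
  \<comment> \<open>Separates the values x from the outcome: for fixed x only the weights vary, so
    \<open>sx\<close> is measurable for \<open>G\<close>, as disintegration requires. The image of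
    \<open>P \<omega>\<close> under \<open>sx \<omega>\<close> is the conditional law of S.\<close>
  define sx where "sx = (\<lambda>\<omega> x. \<Sum>k=1..n. W n k \<omega> * real (x k))"
  have S_sx: "S \<omega> = sx \<omega> (\<lambda>k. if k \<in> I then X k \<omega> else 0)" for \<omega>
    unfolding S_def sx_def I_def by (intro sum.cong) auto
  have sx_G [measurable]: "(\<lambda>\<omega>. sx \<omega> x) \<in> borel_measurable G" for x :: "nat \<Rightarrow> nat"
    unfolding sx_def using W_G by (intro borel_measurable_sum borel_measurable_times) (auto simp: I_def)
  have dis: "(\<lambda>\<omega>. \<integral>\<^sup>+ x. \<phi> (sx \<omega> x) \<partial>measure_pmf (P \<omega>)) \<in> borel_measurable M"
    "(\<integral>\<^sup>+ \<omega>. \<phi> (S \<omega>) \<partial>M) = (\<integral>\<^sup>+ \<omega>. \<integral>\<^sup>+ x. \<phi> (sx \<omega> x) \<partial>measure_pmf (P \<omega>) \<partial>M)"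
    if [measurable]: "\<phi> \<in> borel_measurable borel" for \<phi> :: "real \<Rightarrow> ennreal"
  proof -
    note d = G.disintegration_cond_indep[where \<psi> = "\<lambda>\<omega> x. \<phi> (sx \<omega> x)", OF _ X_M assms(7)[folded G_def] _ law]
    show "(\<lambda>\<omega>. \<integral>\<^sup>+ x. \<phi> (sx \<omega> x) \<partial>measure_pmf (P \<omega>)) \<in> borel_measurable M"
      unfolding P_def by (rule measurable_from_subalg[OF sub d(1)]) (auto simp: I_def)
    show "(\<integral>\<^sup>+ \<omega>. \<phi> (S \<omega>) \<partial>M) = (\<integral>\<^sup>+ \<omega>. \<integral>\<^sup>+ x. \<phi> (sx \<omega> x) \<partial>measure_pmf (P \<omega>) \<partial>M)"
      unfolding P_def S_sx by (rule d(2)) (auto simp: I_def)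
  qed
  show ?thesis
  \<comment> \<open>An infinite right-hand side leaves nothing to show. A finite one is used to make
    S integrable; for a non-integrable h(S) the integral in \<open>d11\<close> would be the default
    value 0 and the Stein equation could not be integrated.\<close>
  proof (cases "(\<integral>\<^sup>+ \<omega>. \<epsilon> \<omega> \<partial>M) = \<infinity>")
    case True
    thus ?thesis unfolding \<epsilon>_def by simp
  next
    case False
    define a where "a = (\<lambda>\<omega>. \<integral>\<^sup>+ x. ennreal (sx \<omega> x) \<partial>measure_pmf (P \<omega>))"
    have [measurable]: "a \<in> borel_measurable M" unfolding a_def by (rule dis(1)) simp
    \<comment> \<open>Truncated subtraction keeps \<theta> on the side of the measurable function
      \<open>a\<close>; pulling \<theta> out of the integral of \<theta> + \<open>\<epsilon>\<close>
      would ask for measurability of \<open>\<epsilon>\<close>.\<close>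
    have a_le: "(\<integral>\<^sup>+ \<omega>. a \<omega> - ennreal \<theta> \<partial>M) \<le> (\<integral>\<^sup>+ \<omega>. \<epsilon> \<omega> \<partial>M)"
    proof (rule nn_integral_mono_AE)
      show "AE \<omega> in M. a \<omega> - ennreal \<theta> \<le> \<epsilon> \<omega>"
        using ae
      proof eventually_elim
        case (elim \<omega>)
        have int: "integrable (measure_pmf (P \<omega>)) (\<lambda>x. real (x k))"
          "measure_pmf.expectation (P \<omega>) (\<lambda>x. real (x k)) = lam k \<omega>" if "k \<in> I" for k
          using integrable_Pi_pmf_component[where I = I and k = k and p = "\<lambda>k. \<kappa> k \<omega>" and \<phi> = real] that elim
          unfolding P_def by (auto simp: I_def)
        have "integrable (measure_pmf (P \<omega>)) (sx \<omega>)"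
          unfolding sx_def using int by (auto simp: I_def)
        moreover have "0 \<le> sx \<omega> x" for x
          unfolding sx_def using elim by (auto simp: I_def intro!: sum_nonneg)
        ultimately have "(\<integral>\<^sup>+ x. ennreal (sx \<omega> x) \<partial>measure_pmf (P \<omega>)) = ennreal (measure_pmf.expectation (P \<omega>) (sx \<omega>))"
          by (intro nn_integral_eq_integral) auto
        also have "measure_pmf.expectation (P \<omega>) (sx \<omega>) = (\<Sum>k=1..n. W n k \<omega> * lam k \<omega>)"
          unfolding sx_def using int by (subst Bochner_Integration.integral_sum) (auto simp: I_def)
        also have "\<dots> = (\<Sum>k=1..n. lam k \<omega> * W n k \<omega>)" by (simp add: mult.commute)
        also have "ennreal \<dots> \<le> ennreal \<theta> + \<epsilon> \<omega>"
          unfolding \<epsilon>_def using elim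
          by (intro grid_mean_le_eps11 assms(2,3)) (auto simp: I_def intro!: integral_nonneg_AE)
        finally show ?case by (simp add: a_def ennreal_minus_le_iff)
      qed
    qed
    have "(\<integral>\<^sup>+ \<omega>. ennreal (S \<omega>) \<partial>M) = (\<integral>\<^sup>+ \<omega>. a \<omega> \<partial>M)"
      unfolding a_def by (rule dis(2)) simp
    also have "\<dots> \<le> (\<integral>\<^sup>+ \<omega>. (a \<omega> - ennreal \<theta>) + ennreal \<theta> \<partial>M)"
    proof (rule nn_integral_mono)
      show "a \<omega> \<le> (a \<omega> - ennreal \<theta>) + ennreal \<theta>" for \<omega>
        using ennreal_minus_le_iff[of "a \<omega>" "ennreal \<theta>" "a \<omega> - ennreal \<theta>"] by (simp add: add.commute)
    qed
    also have "\<dots> = (\<integral>\<^sup>+ \<omega>. a \<omega> - ennreal \<theta> \<partial>M) + ennreal \<theta>"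
      by (simp add: nn_integral_add emeasure_space_1)
    also have "\<dots> < \<infinity>"
      using a_le False by (simp add: less_top top_unique)
    finally have S_int: "integrable M S"
    proof (intro integrableI_bounded S_M)
      assume "(\<integral>\<^sup>+ \<omega>. ennreal (S \<omega>) \<partial>M) < \<infinity>"
      also have "(\<integral>\<^sup>+ \<omega>. ennreal (S \<omega>) \<partial>M) = (\<integral>\<^sup>+ \<omega>. ennreal (norm (S \<omega>)) \<partial>M)"
        by (rule nn_integral_cong_AE) (use S_nonneg in \<open>eventually_elim, simp\<close>)
      finally show "(\<integral>\<^sup>+ \<omega>. ennreal (norm (S \<omega>)) \<partial>M) < \<infinity>" .
    qed
    have "ennreal \<bar>(\<integral>x. h x \<partial>distr M borel S) - (\<integral>x. h x \<partial>D)\<bar> \<le> (\<integral>\<^sup>+ \<omega>. \<epsilon> \<omega> \<partial>M)" if h: "h \<in> H11" for h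
    proof -
      obtain f F where f_bd: "\<And>x. \<bar>f x\<bar> \<le> 1" and f_lip: "(1/2)-lipschitz_on UNIV f"
        and F: "\<And>x. (F has_real_derivative f x) (at x)"
        and stein: "\<And>x. x \<ge> 0 \<Longrightarrow> x * f x - \<theta> * (F (x + 1) - F x) = h x - (\<integral>x. h x \<partial>D)"
        using stein_solution[OF assms(2,15) h] by metis
      define \<Psi> where "\<Psi> = (\<lambda>x. x * f x - \<theta> * (F (x + 1) - F x))"
      have h_lip: "1-lipschitz_on UNIV h" using h by (simp add: H11_def)
      have [measurable]: "h \<in> borel_measurable borel" "f \<in> borel_measurable borel" "F \<in> borel_measurable borel"
        using lipschitz_on_continuous_on[OF h_lip] lipschitz_on_continuous_on[OF f_lip]
          lipschitz_on_continuous_on[OF lipschitz_on_UNIV_deriv[OF F f_bd]]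
        by (auto intro: borel_measurable_continuous_onI)
      have [measurable]: "\<Psi> \<in> borel_measurable borel" unfolding \<Psi>_def by measurable
      have h_int: "integrable M (\<lambda>\<omega>. h (S \<omega>))"
        by (rule lipschitz_integrable[OF h_lip finite_measure_axioms S_int])
      \<comment> \<open>The Stein equation is available only for nonnegative arguments, hence almost
        surely along S. Through it, integrability passes from h(S) to the Stein expression.\<close>
      have eq: "AE \<omega> in M. h (S \<omega>) - (\<integral>x. h x \<partial>D) = \<Psi> (S \<omega>)"
        using S_nonneg by eventually_elim (simp add: \<Psi>_def stein)
      have "integrable M (\<lambda>\<omega>. h (S \<omega>) - (\<integral>x. h x \<partial>D))" using h_int by simp
      hence \<Psi>_int: "integrable M (\<lambda>\<omega>. \<Psi> (S \<omega>))"
        by (rule integrable_cong_AE_imp) (use S_M eq in \<open>auto intro: measurable_compose\<close>)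
      have "(\<integral>x. h x \<partial>distr M borel S) - (\<integral>x. h x \<partial>D) = (\<integral>\<omega>. h (S \<omega>) - (\<integral>x. h x \<partial>D) \<partial>M)"
        using h_int S_M by (simp add: integral_distr prob_space)
      also have "\<dots> = (\<integral>\<omega>. \<Psi> (S \<omega>) \<partial>M)"
        by (rule integral_cong_AE) (use eq h_int \<Psi>_int in auto)
      also have "ennreal \<bar>\<dots>\<bar> \<le> (\<integral>\<^sup>+ \<omega>. \<epsilon> \<omega> \<partial>M)"
      proof (rule abs_integral_disintegration_le[where K = "\<lambda>\<omega>. measure_pmf (P \<omega>)" and g = "\<lambda>\<omega> x. \<Psi> (sx \<omega> x)", OF \<Psi>_int])
        show "AE \<omega> in M. integrable (measure_pmf (P \<omega>)) (\<lambda>x. \<Psi> (sx \<omega> x)) \<longrightarrow>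
          ennreal \<bar>measure_pmf.expectation (P \<omega>) (\<lambda>x. \<Psi> (sx \<omega> x))\<bar> \<le> \<epsilon> \<omega>"
          using ae
        proof eventually_elim
          case (elim \<omega>)
          show ?case unfolding \<Psi>_def sx_def P_def \<epsilon>_def I_def using elim
            by (intro impI deterministic_weights_error assms(2,3) f_bd f_lip F) (auto simp: I_def)
        qed
      qed (use dis[of "\<lambda>x. ennreal (\<Psi> x)"] dis[of "\<lambda>x. ennreal (- \<Psi> x)"] in simp_all)
      finally show ?thesis .
    qed
    thus ?thesis unfolding d11_def S_def[symmetric] \<epsilon>_def[symmetric] by (intro SUP_least)
  qed
qed

end
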